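(* Let $W=G_1/G_1'$ be the ratio of two independent exponential$(1)$ random variables, having density $F_W(dx)/dx=(1+x)^{-2}$ for $x>0$. Let $T_1$ be a $\mathrm{GGC}(1,F_W)$ random variable, with $$\psi_{F_W}(\lambda)=\mathbb{E}[\log(1+\lambda W)]=\frac{\lambda}{\lambda-1}\log(\lambda)$$ (for $\lambda>0$, interpreted as the limit $1$ at $\lambda=1$). Then $T_1\overset{d}{=}G_1M_1(F_W)$, where $M_1(F_W)$ has density $$\xi_{F_W}(x)=\frac1\pi\sin\!\left(\frac{\pi x}{1+x}\right)x^{-\frac{x}{1+x}},\qquad x>0.$$
   Context: Dirichlet process and Dirichlet mean: for $\theta>0$ and a probability distribution $F$ on $[0,\infty)$, a Dirichlet process $P_\theta$ with total mass $\theta$ and parameter $F$ is a random probability measure on $[0,\infty)$ such that for every finite measurable partition $(C_1,\dots,C_k)$ of $[0,\infty)$ the vector $(P_\theta(C_1),\dots,P_\theta(C_k))$ is Dirichlet distributed with parameters $(\theta F(C_1),\dots,\theta F(C_k))$. The Dirichlet mean is $M_\theta(F)\overset{d}{=}\int_0^\infty x\,P_\theta(dx)$. A $\mathrm{GGC}(\theta,F)$ random variable is a non-negative random variable with Laplace transform $e^{-\theta\psi_F(\lambda)}$, $\lambda\ge0$, where $\psi_F(\lambda)=\int_0^\infty\log(1+\lambda x)F(dx)$. $G_1$ denotes a gamma$(1,1)$ (exponential) random variable; in the product $G_1M_1(F_W)$ the factors are independent. *)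

theory Defs
  imports "HOL-Probability.Probability"
begin

abbreviation nonneg_borel :: "real measure" where
  "nonneg_borel \<equiv> restrict_space borel {0..}"

text \<open>The law of an (almost surely) non-negative random variable, as a measure on \<open>[0, \<infinity>)\<close>.\<close>

definition nonneg_law :: "'a measure \<Rightarrow> ('a \<Rightarrow> real) \<Rightarrow> real measure" where
  "nonneg_law \<Omega> X = restrict_space (distr \<Omega> borel X) {0..}"

text \<open>The gamma distribution with shape \<open>a\<close> and scale 1; shape 0 is the point mass at 0.\<close>

definition gamma_law :: "real \<Rightarrow> real measure" where
  "gamma_law a =
     (if a = 0 then return borel 0
      else density lborel
        (\<lambda>x. ennreal (if x > 0 then x powr (a - 1) * exp (- x) / Gamma a else 0)))"

text \<open>
  The Dirichlet distribution in Ferguson's form: the law of a vector of independent gamma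
  variables with shapes \<open>a i\<close>, divided by its sum. Some (not all) parameters may be 0, which
  is needed for partitions containing null sets; those coordinates are almost surely 0.
\<close>

definition dirichlet_law :: "nat \<Rightarrow> (nat \<Rightarrow> real) \<Rightarrow> (nat \<Rightarrow> real) measure" where
  "dirichlet_law k a =
     distr (\<Pi>\<^sub>M i\<in>{..<k}. gamma_law (a i)) (\<Pi>\<^sub>M i\<in>{..<k}. borel)
       (\<lambda>g. \<lambda>i\<in>{..<k}. g i / (\<Sum>j<k. g j))"

definition dirichlet_process ::
    "'a measure \<Rightarrow> real \<Rightarrow> real measure \<Rightarrow> ('a \<Rightarrow> real measure) \<Rightarrow> bool" where
  "dirichlet_process \<Omega> \<theta> F P \<longleftrightarrow>
     prob_space \<Omega> \<and> \<theta> > 0 \<and> F \<in> space (prob_algebra nonneg_borel) \<and>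
     P \<in> measurable \<Omega> (prob_algebra nonneg_borel) \<and>
     (\<forall>k C. (\<forall>i<k. C i \<in> sets nonneg_borel) \<and> disjoint_family_on C {..<k} \<and>
            (\<Union>i<k. C i) = {0..} \<longrightarrow>
        distr \<Omega> (\<Pi>\<^sub>M i\<in>{..<k}. borel) (\<lambda>\<omega>. \<lambda>i\<in>{..<k}. measure (P \<omega>) (C i)) =
        dirichlet_law k (\<lambda>i. \<theta> * measure F (C i)))"

text \<open>
  The mean functional of a random probability measure. The Bochner integral is 0 where the
  mean is infinite, so the value is meaningful only where \<open>\<lambda>x. x\<close> is integrable.
\<close>

definition random_mean :: "('a \<Rightarrow> real measure) \<Rightarrow> 'a \<Rightarrow> real" where
  "random_mean P \<omega> = (\<integral>x. x \<partial>P \<omega>)"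

definition psi :: "real measure \<Rightarrow> real \<Rightarrow> real" where
  "psi F l = (\<integral>x. ln (1 + l * x) \<partial>F)"

text \<open>
  The integrability condition says that \<open>psi F\<close> is finite. It is implicit in the requirement
  on the Laplace transform, but has to be stated because the Bochner integral of a
  non-integrable function is 0.
\<close>

definition GGC :: "'a measure \<Rightarrow> real \<Rightarrow> real measure \<Rightarrow> ('a \<Rightarrow> real) \<Rightarrow> bool" where
  "GGC \<Omega> \<theta> F T \<longleftrightarrow>
     prob_space \<Omega> \<and> \<theta> > 0 \<and> F \<in> space (prob_algebra nonneg_borel) \<and>
     T \<in> borel_measurable \<Omega> \<and> (AE \<omega> in \<Omega>. T \<omega> \<ge> 0) \<and>
     (\<forall>l\<ge>0. integrable F (\<lambda>x. ln (1 + l * x)) \<and>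
             (\<integral>\<omega>. exp (- l * T \<omega>) \<partial>\<Omega>) = exp (- \<theta> * psi F l))"

definition xi :: "real \<Rightarrow> real" where
  "xi x = (if x > 0
           then 1 / pi * sin (pi * x / (1 + x)) * x powr (- (x / (1 + x)))
           else 0)"

end

theory Submission
  imports Defs "HOL-Complex_Analysis.Complex_Analysis" "HOL-Real_Asymp.Real_Asymp"
begin

text \<open>
  Why the theorem holds. Write \<open>\<psi>\<close> for \<open>psi FW\<close>.

  The law of \<open>W\<close> and the closed form of \<open>\<psi>\<close> are elementary: the first is a change of variables in a
  double integral (\<open>distributed_exponential_ratio\<close>), the second an explicit antiderivative
  (\<open>nn_integral_ln_ratio_density\<close>).

  The link between the GGC variable and the Dirichlet mean is the Markov-Krein identity
  \<open>\<^bold>E (1 / (1 + l M)) = exp (- \<psi> l)\<close>. For a function \<open>f\<close> with finitely many values \<open>c\<^sub>i\<close>, the integral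
  \<open>\<integral>f dP\<close> is \<open>\<Sum>c\<^sub>i p\<^sub>i\<close> with a Dirichlet vector \<open>p\<close>, that is, \<open>\<Sum>c\<^sub>i g\<^sub>i / S\<close> with independent gamma variables
  \<open>g\<^sub>i\<close> and \<open>S = \<Sum>g\<^sub>i\<close>. Since the total mass is 1, \<open>S\<close> is exponential and independent of \<open>p\<close>, so
  \<open>\<^bold>E (1 / (1 + \<Sum>c\<^sub>i p\<^sub>i)) = \<^bold>E (exp (- \<Sum>c\<^sub>i g\<^sub>i)) = \<Prod>(1 + c\<^sub>i) powr (- a\<^sub>i)\<close>; this is
  \<open>nn_integral_dirichlet_law\<close>, where the independence enters only through a scaling argument.
  Letting simple functions increase to the identity gives the transform of the mean
  (\<open>dirichlet_mean_transform\<close>). A priori the mean might be infinite with positive probability, but the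
  limit \<open>l \<rightarrow> 0\<close> of the identity shows that it is not, because \<open>\<psi> l \<rightarrow> 0\<close>.

  Multiplying \<open>M\<close> by an independent exponential \<open>G\<close> turns \<open>\<^bold>E (1 / (1 + l M))\<close> into the Laplace transform of
  \<open>G M\<close>, which therefore agrees with that of \<open>T\<close>. Equality of the laws follows since the
  moments of a variable with values in \<open>[0, 1]\<close> determine its law (\<open>distr_eq_of_moments_eq\<close>, applied to
  \<open>exp (- T)\<close> and \<open>exp (- G M)\<close>).

  For the density it remains to see that \<open>xi\<close> has the same transform, that is
  \<open>\<integral>xi x / (1 + l x) dx = exp (- \<psi> l)\<close>. With \<open>l = 1 / w\<close> this says that
  \<open>H w = exp (w / (1 - w) * ln w)\<close> is the Cauchy-Stieltjes transform of \<open>xi\<close>. Indeed \<open>H\<close> is holomorphic off the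
  negative axis, its value just below \<open>- x\<close> minus the value just above is \<open>2 pi \<i> xi x\<close>, and it decays like \<open>1 / w\<close> at infinity. In the variable
  \<open>z = ln w\<close> the slit plane becomes the strip \<open>\<bar>Im z\<bar> < pi\<close>, \<open>H\<close> extends across the boundary of the
  strip, and the keyhole contour becomes a rectangle, so that Cauchy's formula in a convex set
  suffices (\<open>rectangle_integral_estimate\<close>, \<open>nn_integral_xi_Stieltjes\<close>). Finally the
  transform \<open>\<^bold>E (1 / (1 + l M))\<close> determines the law of \<open>M\<close> (\<open>distr_eq_of_Stieltjes_eq\<close>).
\<close>

section \<open>Gamma laws\<close>

lemma sets_gamma_law [simp, measurable_cong]: "sets (gamma_law a) = sets borel"
  by (simp add: gamma_law_def)

lemma space_gamma_law [simp]: "space (gamma_law a) = UNIV"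
  by (simp add: gamma_law_def)

lemma prob_space_gamma_law:
  assumes "0 \<le> a"
  shows "prob_space (gamma_law a)"
proof (cases "a = 0")
  case True
  then show ?thesis
    by (simp add: gamma_law_def prob_space_return)
next
  case False
  with assms have a: "a > 0" by simp
  have G: "Gamma a > 0" using a by (rule Gamma_real_pos)
  have "emeasure (gamma_law a) UNIV
      = (\<integral>\<^sup>+x. ennreal (if x > 0 then x powr (a - 1) * exp (- x) / Gamma a else 0) \<partial>lborel)"
    using False by (simp add: gamma_law_def emeasure_density)
  also have "\<dots> = (\<integral>\<^sup>+x. ennreal (1 / Gamma a) * ennreal (indicator {0..} x * x powr (a - 1) / exp x) \<partial>lborel)"
    using G by (intro nn_integral_cong)
      (auto simp: ennreal_mult[symmetric] exp_minus field_simps indicator_def)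
  also have "\<dots> = ennreal (1 / Gamma a) * ennreal (Gamma a)"
    using Gamma_conv_nn_integral_real[OF a] by (subst nn_integral_cmult) auto
  also have "\<dots> = 1"
    using G by (simp add: ennreal_mult[symmetric])
  finally show ?thesis
    by (intro prob_spaceI) simp
qed

text \<open>
  Exponential tilting of a gamma law is the same as rescaling it. The identity also holds for the point
  mass with shape 0. Comparing total masses gives the Laplace transform; applied coordinatewise, the identity
  drives the computation for the Dirichlet distribution.
\<close>

lemma gamma_law_tilt:
  assumes a: "0 \<le> a" and s: "0 < s"
  shows "density (gamma_law a) (\<lambda>x. ennreal (s powr a * exp (- (s - 1) * x))) = distr (gamma_law a) borel (\<lambda>x. x / s)"
proof (rule measure_eqI)
  fix A assume "A \<in> sets (density (gamma_law a) (\<lambda>x. ennreal (s powr a * exp (- (s - 1) * x))))"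
  then have A[measurable]: "A \<in> sets borel" by simp
  show "emeasure (density (gamma_law a) (\<lambda>x. ennreal (s powr a * exp (- (s - 1) * x)))) A
      = emeasure (distr (gamma_law a) borel (\<lambda>x. x / s)) A"
  proof (cases "a = 0")
    case True
    have "emeasure (density (gamma_law a) (\<lambda>x. ennreal (s powr a * exp (- (s - 1) * x)))) A = indicator A 0"
      using True s by (subst emeasure_density) (auto simp: gamma_law_def nn_integral_return)
    also have "\<dots> = emeasure (distr (gamma_law a) borel (\<lambda>x. x / s)) A"
      using True s measurable_sets_borel[OF _ A, of "\<lambda>x. x / s"]
      by (subst emeasure_distr) (auto simp: gamma_law_def indicator_def)
    finally show ?thesis .
  next
    case False
    with a have a: "a > 0" by simp
    have G: "Gamma a > 0" using a by (rule Gamma_real_pos)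
    let ?f = "\<lambda>x. if x > 0 then x powr (a - 1) * exp (- x) / Gamma a else 0"
    have "emeasure (distr (gamma_law a) borel (\<lambda>x. x / s)) A = (\<integral>\<^sup>+x. indicator A x \<partial>distr (gamma_law a) borel (\<lambda>x. x / s))"
      by simp
    also have "\<dots> = (\<integral>\<^sup>+x. indicator A (x / s) \<partial>gamma_law a)"
      by (subst nn_integral_distr) auto
    also have "\<dots> = (\<integral>\<^sup>+x. ennreal (?f x) * indicator A (x / s) \<partial>lborel)"
      using False by (simp add: gamma_law_def nn_integral_density)
    also have "\<dots> = ennreal s * (\<integral>\<^sup>+x. ennreal (?f (s * x)) * indicator A x \<partial>lborel)"
      using s by (subst nn_integral_real_affine[where c=s and t=0]) (simp_all cong: if_cong)
    also have "\<dots> = (\<integral>\<^sup>+x. ennreal s * (ennreal (?f (s * x)) * indicator A x) \<partial>lborel)"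
      by (subst nn_integral_cmult) auto
    also have "\<dots> = (\<integral>\<^sup>+x. ennreal (?f x) * (ennreal (s powr a * exp (- (s - 1) * x)) * indicator A x) \<partial>lborel)"
    proof (rule nn_integral_cong)
      fix x :: real
      have "s * ?f (s * x) = ?f x * (s powr a * exp (- (s - 1) * x))"
      proof (cases "x > 0")
        case True
        have "s * s powr (a - 1) = s powr a"
          using s by (simp add: powr_diff)
        moreover have "exp (- x) * exp (- (s - 1) * x) = exp (- (s * x))"
          by (simp add: exp_add[symmetric] algebra_simps)
        moreover have "(s * x) powr (a - 1) = s powr (a - 1) * x powr (a - 1)"
          using s True by (simp add: powr_mult)
        ultimately have "s * ((s * x) powr (a - 1) * exp (- (s * x)) / Gamma a)
           = (x powr (a - 1) * exp (- x) / Gamma a) * (s powr a * exp (- (s - 1) * x))"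
          by (metis (no_types, opaque_lifting) mult.assoc mult.commute times_divide_eq_left)
        then show ?thesis
          using s True by simp
      next
        case False
        then show ?thesis using s by (simp add: zero_less_mult_iff)
      qed
      moreover have "0 \<le> ?f (s * x)" "0 \<le> ?f x" for x
        using G by auto
      ultimately have "ennreal s * ennreal (?f (s * x)) = ennreal (?f x) * ennreal (s powr a * exp (- (s - 1) * x))"
        using s by (subst (1 2) ennreal_mult[symmetric]) auto
      then show "ennreal s * (ennreal (?f (s * x)) * indicator A x)
          = ennreal (?f x) * (ennreal (s powr a * exp (- (s - 1) * x)) * indicator A x)"
        by (metis mult.assoc)
    qed
    also have "\<dots> = (\<integral>\<^sup>+x. ennreal (s powr a * exp (- (s - 1) * x)) * indicator A x \<partial>gamma_law a)"
      using False by (simp add: gamma_law_def nn_integral_density)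
    also have "\<dots> = emeasure (density (gamma_law a) (\<lambda>x. ennreal (s powr a * exp (- (s - 1) * x)))) A"
      by (subst emeasure_density) auto
    finally show ?thesis ..
  qed
qed simp

lemma gamma_law_Laplace:
  assumes a: "0 \<le> a" and c: "0 \<le> c"
  shows "(\<integral>\<^sup>+x. ennreal (exp (- c * x)) \<partial>gamma_law a) = ennreal ((1 + c) powr (- a))"
proof -
  interpret prob_space "gamma_law a" by (rule prob_space_gamma_law[OF a])
  interpret D: prob_space "distr (gamma_law a) borel (\<lambda>x. x / (1 + c))"
    by (rule prob_space_distr) simp
  have "1 = emeasure (density (gamma_law a) (\<lambda>x. ennreal ((1 + c) powr a * exp (- ((1 + c) - 1) * x)))) UNIV"
    using c by (subst gamma_law_tilt[OF a]) (use D.emeasure_space_1 in auto)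
  also have "\<dots> = (\<integral>\<^sup>+x. ennreal ((1 + c) powr a) * ennreal (exp (- c * x)) \<partial>gamma_law a)"
    by (subst emeasure_density) (auto simp: ennreal_mult)
  also have "\<dots> = ennreal ((1 + c) powr a) * (\<integral>\<^sup>+x. ennreal (exp (- c * x)) \<partial>gamma_law a)"
    by (subst nn_integral_cmult) auto
  finally have 1: "1 = ennreal ((1 + c) powr a) * (\<integral>\<^sup>+x. ennreal (exp (- c * x)) \<partial>gamma_law a)" .
  have "ennreal ((1 + c) powr (- a)) = ennreal ((1 + c) powr (- a)) * (ennreal ((1 + c) powr a) * (\<integral>\<^sup>+x. ennreal (exp (- c * x)) \<partial>gamma_law a))"
    by (subst 1[symmetric]) simp
  also have "\<dots> = ennreal ((1 + c) powr (- a) * (1 + c) powr a) * (\<integral>\<^sup>+x. ennreal (exp (- c * x)) \<partial>gamma_law a)"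
    by (simp add: ennreal_mult mult.assoc)
  also have "(1 + c) powr (- a) * (1 + c) powr a = 1"
    using c by (simp add: powr_add[symmetric])
  finally show ?thesis by simp
qed

lemma AE_gamma_law_pos: "a \<noteq> 0 \<Longrightarrow> AE x in gamma_law a. 0 < x"
  unfolding gamma_law_def by (simp, subst AE_density) (auto intro!: AE_I2)

lemma AE_gamma_law_nonneg: "AE x in gamma_law a. 0 \<le> x"
proof (cases "a = 0")
  case True
  then show ?thesis
    unfolding gamma_law_def by (simp, subst AE_return) auto
next
  case False
  show ?thesis
    by (rule eventually_mono[OF AE_gamma_law_pos[OF False]]) simp
qed

text \<open>
  This is \<open>\<integral>exp (- b r) dr\<close> over the half line after the substitution \<open>r = 1 / s\<close>.
\<close>

lemma nn_integral_inverse_exponential: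
  fixes b :: real
  assumes b: "0 < b"
  shows "(\<integral>\<^sup>+s. ennreal (if 0 < s then exp (- (b / s)) / s\<^sup>2 else 0) \<partial>lborel) = ennreal (1 / b)"
proof -
  let ?F = "\<lambda>s. exp (- (b / s)) / b" and ?f = "\<lambda>s. exp (- (b / s)) / s\<^sup>2"
  have D: "DERIV ?F s :> ?f s" if "0 < s" for s
    using that b by (auto intro!: derivative_eq_intros simp: power2_eq_square)
  have l0: "((?F \<circ> real_of_ereal) \<longlongrightarrow> 0) (at_right (ereal 0))"
    unfolding ereal_tendsto_simps using b by real_asymp
  have "(?F \<longlongrightarrow> inverse b) at_top"
    using b by real_asymp
  then have l1: "((?F \<circ> real_of_ereal) \<longlongrightarrow> 1 / b) (at_left \<infinity>)"
    unfolding ereal_tendsto_simps by (simp add: divide_inverse)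
  have c: "isCont ?f s" if "0 < s" for s
    using that by (auto intro!: continuous_intros)
  note FTC = interval_integral_FTC_nonneg[of "ereal 0" \<infinity> ?F ?f, OF _ _ _ _ l0 l1]
  have "set_integrable lborel (einterval (ereal 0) \<infinity>) ?f" "(LBINT x=ereal 0..\<infinity>. ?f x) = 1 / b - 0"
    by (rule FTC; use D c in simp)+
  then have "integrable lborel (\<lambda>s. indicator {0<..} s *\<^sub>R ?f s)" and I: "(\<integral>s. indicator {0<..} s *\<^sub>R ?f s \<partial>lborel) = 1 / b"
    by (auto simp: set_integrable_def interval_lebesgue_integral_def set_lebesgue_integral_def)
  then have "(\<integral>\<^sup>+s. ennreal (indicator {0<..} s *\<^sub>R ?f s) \<partial>lborel) = ennreal (1 / b)"
    by (subst nn_integral_eq_integral) auto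
  moreover have "(\<lambda>s. ennreal (if 0 < s then exp (- (b / s)) / s\<^sup>2 else 0)) = (\<lambda>s. ennreal (indicator {0<..} s *\<^sub>R ?f s))"
    by (auto simp: indicator_def)
  ultimately show ?thesis
    by simp
qed

section \<open>The Markov-Krein identity for Dirichlet vectors\<close>

text \<open>
  The tilting identity for a vector of independent gamma variables. Both sides integrate \<open>h\<close> against
  the product of the rescaled gamma laws, which is seen on boxes.
\<close>

lemma product_gamma_law_tilt:
  fixes a :: "nat \<Rightarrow> real" and k :: nat
  defines "\<mu> \<equiv> \<Pi>\<^sub>M i\<in>{..<k}. gamma_law (a i)"
  assumes a: "\<And>i. i < k \<Longrightarrow> 0 \<le> a i" and s: "0 < s"
    and h[measurable]: "h \<in> borel_measurable (\<Pi>\<^sub>M i\<in>{..<k}. borel)"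
  shows "(\<integral>\<^sup>+g. ennreal (s powr (\<Sum>i<k. a i) * exp (- (s - 1) * (\<Sum>i<k. g i))) * h g \<partial>\<mu>)
       = (\<integral>\<^sup>+g. h (\<lambda>i\<in>{..<k}. g i / s) \<partial>\<mu>)"
proof -
  \<comment> \<open>The locale of product measures wants a probability measure at every index, not only below \<open>k\<close>.\<close>
  define L where "L i = (if i < k then gamma_law (a i) else gamma_law 0)" for i
  define Q where "Q i = distr (L i) borel (\<lambda>x. x / s)" for i
  have muL: "\<mu> = PiM {..<k} L"
    unfolding \<mu>_def L_def by (intro PiM_cong) auto
  have setsL [measurable_cong, simp]: "sets (L i) = sets borel" "space (L i) = UNIV" for i
    by (auto simp: L_def)
  have setsQ [measurable_cong, simp]: "sets (Q i) = sets borel" for i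
    by (auto simp: Q_def)
  have setsmu [measurable_cong]: "sets \<mu> = sets (\<Pi>\<^sub>M i\<in>{..<k}. borel)"
    unfolding muL by (intro sets_PiM_cong) auto
  have Lprob: "prob_space (L i)" for i
    using a by (auto simp: L_def intro!: prob_space_gamma_law)
  have Qprob: "prob_space (Q i)" for i
    unfolding Q_def by (intro prob_space.prob_space_distr Lprob) simp
  interpret L: product_sigma_finite L
    unfolding product_sigma_finite_def using Lprob by (auto intro!: prob_space_imp_sigma_finite)
  interpret Q: product_sigma_finite Q
    unfolding product_sigma_finite_def using Qprob by (auto intro!: prob_space_imp_sigma_finite)
  let ?w = "\<lambda>i x. ennreal (s powr a i * exp (- (s - 1) * x))"
  have tilt: "density (L i) (?w i) = Q i" if "i < k" for i
    using gamma_law_tilt[OF a[OF that] s] that by (simp add: Q_def L_def)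
  have weight: "ennreal (s powr (\<Sum>i<k. a i) * exp (- (s - 1) * (\<Sum>i<k. g i))) = (\<Prod>i<k. ?w i (g i))" for g
    using s by (subst prod_ennreal)
      (auto simp: prod.distrib powr_sum sum_distrib_left exp_sum)
  have D: "density \<mu> (\<lambda>g. \<Prod>i<k. ?w i (g i)) = PiM {..<k} Q"
  proof (rule Q.PiM_eqI)
    show "sets (density \<mu> (\<lambda>g. \<Prod>i<k. ?w i (g i))) = sets (PiM {..<k} Q)"
      using setsmu by (simp cong: sets_PiM_cong)
    fix A assume A: "\<And>i. i \<in> {..<k} \<Longrightarrow> A i \<in> sets (Q i)"
    then have A': "A i \<in> sets borel" if "i < k" for i using that by simp
    have [measurable]: "Pi\<^sub>E {..<k} A \<in> sets \<mu>"
      unfolding muL using A' by (intro sets_PiM_I_finite) auto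
    have "emeasure (density \<mu> (\<lambda>g. \<Prod>i<k. ?w i (g i))) (Pi\<^sub>E {..<k} A)
       = (\<integral>\<^sup>+g. (\<Prod>i<k. ?w i (g i)) * indicator (Pi\<^sub>E {..<k} A) g \<partial>\<mu>)"
      by (subst emeasure_density) auto
    also have "\<dots> = (\<integral>\<^sup>+g. (\<Prod>i<k. ?w i (g i) * indicator (A i) (g i)) \<partial>PiM {..<k} L)"
      unfolding muL
    proof (rule nn_integral_cong)
      fix g assume "g \<in> space (PiM {..<k} L)"
      then have "g \<in> extensional {..<k}"
        by (auto simp: space_PiM PiE_def)
      then have "indicator (Pi\<^sub>E {..<k} A) g = (\<Prod>i<k. indicator (A i) (g i) :: ennreal)"
        by (auto simp: indicator_def PiE_def Pi_iff intro!: prod.neutral)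
      then show "(\<Prod>i<k. ?w i (g i)) * indicator (Pi\<^sub>E {..<k} A) g = (\<Prod>i<k. ?w i (g i) * indicator (A i) (g i))"
        by (simp add: prod.distrib)
    qed
    also have "\<dots> = (\<Prod>i<k. \<integral>\<^sup>+x. ?w i x * indicator (A i) x \<partial>L i)"
      using A' by (subst L.product_nn_integral_prod) auto
    also have "\<dots> = (\<Prod>i<k. emeasure (Q i) (A i))"
      using A' by (intro prod.cong refl) (simp add: tilt[symmetric] emeasure_density)
    finally show "emeasure (density \<mu> (\<lambda>g. \<Prod>i<k. ?w i (g i))) (Pi\<^sub>E {..<k} A) = (\<Prod>i<k. emeasure (Q i) (A i))" .
  qed simp
  have scale [measurable]: "(\<lambda>g. \<lambda>i\<in>{..<k}. g i / s) \<in> measurable \<mu> (\<Pi>\<^sub>M i\<in>{..<k}. borel)"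
    by measurable
  have E: "distr \<mu> (\<Pi>\<^sub>M i\<in>{..<k}. borel) (\<lambda>g. \<lambda>i\<in>{..<k}. g i / s) = PiM {..<k} Q"
  proof (rule Q.PiM_eqI)
    show "sets (distr \<mu> (\<Pi>\<^sub>M i\<in>{..<k}. borel) (\<lambda>g. \<lambda>i\<in>{..<k}. g i / s)) = sets (PiM {..<k} Q)"
      by (simp cong: sets_PiM_cong)
    fix A assume A: "\<And>i. i \<in> {..<k} \<Longrightarrow> A i \<in> sets (Q i)"
    then have A': "A i \<in> sets borel" if "i < k" for i using that by simp
    have vim: "(\<lambda>x. x / s) -` A i \<in> sets borel" if "i < k" for i
      using measurable_sets_borel[OF _ A'[OF that], of "\<lambda>x. x / s"] by simp
    have "emeasure (distr \<mu> (\<Pi>\<^sub>M i\<in>{..<k}. borel) (\<lambda>g. \<lambda>i\<in>{..<k}. g i / s)) (Pi\<^sub>E {..<k} A)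
        = emeasure \<mu> ((\<lambda>g. \<lambda>i\<in>{..<k}. g i / s) -` (Pi\<^sub>E {..<k} A) \<inter> space \<mu>)"
      using A' by (intro emeasure_distr scale sets_PiM_I_finite) auto
    also have "(\<lambda>g. \<lambda>i\<in>{..<k}. g i / s) -` (Pi\<^sub>E {..<k} A) \<inter> space \<mu> = (\<Pi>\<^sub>E i\<in>{..<k}. (\<lambda>x. x / s) -` A i)"
      by (auto simp: muL space_PiM PiE_iff)
    also have "emeasure \<mu> \<dots> = (\<Prod>i<k. emeasure (L i) ((\<lambda>x. x / s) -` A i))"
      unfolding muL using vim by (intro L.emeasure_PiM) auto
    also have "\<dots> = (\<Prod>i<k. emeasure (Q i) (A i))"
      using A' by (intro prod.cong refl) (simp add: Q_def emeasure_distr)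
    finally show "emeasure (distr \<mu> (\<Pi>\<^sub>M i\<in>{..<k}. borel) (\<lambda>g. \<lambda>i\<in>{..<k}. g i / s)) (Pi\<^sub>E {..<k} A) = (\<Prod>i<k. emeasure (Q i) (A i))" .
  qed simp
  have "(\<integral>\<^sup>+g. ennreal (s powr (\<Sum>i<k. a i) * exp (- (s - 1) * (\<Sum>i<k. g i))) * h g \<partial>\<mu>)
      = (\<integral>\<^sup>+g. h g \<partial>density \<mu> (\<lambda>g. \<Prod>i<k. ?w i (g i)))"
    unfolding weight by (subst nn_integral_density) auto
  also have "\<dots> = (\<integral>\<^sup>+g. h g \<partial>distr \<mu> (\<Pi>\<^sub>M i\<in>{..<k}. borel) (\<lambda>g. \<lambda>i\<in>{..<k}. g i / s))"
    by (simp only: D E)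
  also have "\<dots> = (\<integral>\<^sup>+g. h (\<lambda>i\<in>{..<k}. g i / s) \<partial>\<mu>)"
    by (subst nn_integral_distr) auto
  finally show ?thesis .
qed

text \<open>
  The Markov-Krein identity for a Dirichlet vector of total mass 1. With \<open>S = \<Sum>g\<^sub>i\<close> and
  \<open>u = \<Sum>c\<^sub>i g\<^sub>i / S\<close> it says \<open>\<^bold>E (1 / (1 + u)) = \<^bold>E (exp (- u S))\<close>. Both sides are written as
  double integrals over \<open>g\<close> and an auxiliary \<open>s > 0\<close>: the left side by
  \<open>1 / (1 + u) = \<integral>S / s\<^sup>2 exp (- (1 + u) S / s) ds\<close>, the right side by inserting
  \<open>1 = \<integral>S exp (- s S) ds\<close>. For fixed \<open>s\<close> the two integrands differ by the rescaling \<open>g \<mapsto> g / s\<close>,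
  which does not change \<open>u\<close>, so the tilting identity identifies them. This avoids any appeal to the
  independence of \<open>S\<close> and \<open>g / S\<close>.
\<close>

lemma nn_integral_dirichlet_law:
  fixes a c :: "nat \<Rightarrow> real" and k :: nat
  assumes a: "\<And>i. i < k \<Longrightarrow> 0 \<le> a i" and suma: "(\<Sum>i<k. a i) = 1"
    and c: "\<And>i. i < k \<Longrightarrow> 0 \<le> c i"
  shows "(\<integral>\<^sup>+p. ennreal (1 / (1 + (\<Sum>i<k. c i * p i))) \<partial>dirichlet_law k a)
       = ennreal (\<Prod>i<k. (1 + c i) powr (- a i))"
proof -
  define \<mu> where "\<mu> = (\<Pi>\<^sub>M i\<in>{..<k}. gamma_law (a i))"
  have setsmu [measurable_cong]: "sets \<mu> = sets (\<Pi>\<^sub>M i\<in>{..<k}. borel)"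
    unfolding \<mu>_def by (intro sets_PiM_cong) auto
  define S where "S g = (\<Sum>i<k. g i)" for g :: "nat \<Rightarrow> real"
  define u where "u g = (\<Sum>i<k. c i * (g i / S g))" for g :: "nat \<Rightarrow> real"
  have S_meas [measurable]: "S \<in> borel_measurable (\<Pi>\<^sub>M i\<in>{..<k}. borel)"
    unfolding S_def by measurable
  have u_meas [measurable]: "u \<in> borel_measurable (\<Pi>\<^sub>M i\<in>{..<k}. borel)"
    unfolding u_def by measurable
  have S_mu [measurable]: "S \<in> borel_measurable \<mu>" and u_mu [measurable]: "u \<in> borel_measurable \<mu>"
    using S_meas u_meas by (simp_all cong: measurable_cong_sets add: setsmu)
  define L where "L i = (if i < k then gamma_law (a i) else gamma_law 0)" for i
  have muL: "\<mu> = PiM {..<k} L"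
    unfolding \<mu>_def L_def by (intro PiM_cong) auto
  have setsL [measurable_cong, simp]: "sets (L i) = sets borel" for i
    by (auto simp: L_def)
  have Lprob: "prob_space (L i)" for i
    using a by (auto simp: L_def intro!: prob_space_gamma_law)
  interpret L: product_sigma_finite L
    unfolding product_sigma_finite_def using Lprob by (auto intro!: prob_space_imp_sigma_finite)
  interpret mu: prob_space \<mu>
    unfolding muL by (intro prob_space_PiM Lprob)
  interpret P: pair_sigma_finite \<mu> "lborel :: real measure" ..
  have nonneg: "AE g in \<mu>. \<forall>i<k. 0 \<le> g i"
    unfolding AE_all_countable
  proof
    fix i
    show "AE g in \<mu>. i < k \<longrightarrow> 0 \<le> g i"
    proof (cases "i < k")
      case True
      have "AE g in \<mu>. 0 \<le> g i"
        unfolding \<mu>_def using True a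
        by (intro AE_PiM_component AE_gamma_law_nonneg prob_space_gamma_law) auto
      then show ?thesis by eventually_elim simp
    qed simp
  qed
  \<comment> \<open>Some parameters may be 0, but not all; one positive coordinate makes \<open>S\<close> positive.\<close>
  obtain j where j: "j < k" "a j \<noteq> 0"
    using suma by (metis lessThan_iff sum.neutral zero_neq_one)
  have "AE g in \<mu>. 0 < g j"
    unfolding \<mu>_def using j a
    by (intro AE_PiM_component[where P="\<lambda>x. 0 < x"] AE_gamma_law_pos prob_space_gamma_law) auto
  with nonneg have good: "AE g in \<mu>. 0 < S g \<and> 0 \<le> u g \<and> (\<Sum>i<k. c i * g i) = u g * S g"
  proof eventually_elim
    case (elim g)
    have "0 < S g"
      unfolding S_def using elim j by (intro sum_pos2[of _ j]) auto
    then show ?case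
      using elim c by (auto simp: u_def sum_distrib_right intro!: sum_nonneg)
  qed
  have "(\<integral>\<^sup>+p. ennreal (1 / (1 + (\<Sum>i<k. c i * p i))) \<partial>dirichlet_law k a)
      = (\<integral>\<^sup>+g. ennreal (1 / (1 + u g)) \<partial>\<mu>)"
    unfolding dirichlet_law_def \<mu>_def[symmetric] u_def S_def
    by (subst nn_integral_distr) auto
  also have "\<dots> = (\<integral>\<^sup>+g. \<integral>\<^sup>+s. ennreal (if 0 < s then S g / s\<^sup>2 * exp (- ((1 + u g) * S g / s)) else 0) \<partial>lborel \<partial>\<mu>)"
  proof (rule nn_integral_cong_AE)
    show "AE g in \<mu>. ennreal (1 / (1 + u g)) = (\<integral>\<^sup>+s. ennreal (if 0 < s then S g / s\<^sup>2 * exp (- ((1 + u g) * S g / s)) else 0) \<partial>lborel)"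
      using good
    proof eventually_elim
      case (elim g)
      have "(\<integral>\<^sup>+s. ennreal (if 0 < s then S g / s\<^sup>2 * exp (- ((1 + u g) * S g / s)) else 0) \<partial>lborel)
         = (\<integral>\<^sup>+s. ennreal (S g) * ennreal (if 0 < s then exp (- ((1 + u g) * S g / s)) / s\<^sup>2 else 0) \<partial>lborel)"
        using elim by (intro nn_integral_cong) (auto simp: ennreal_mult[symmetric])
      also have "\<dots> = ennreal (S g) * ennreal (1 / ((1 + u g) * S g))"
        using elim by (subst nn_integral_cmult) (auto simp: nn_integral_inverse_exponential)
      also have "\<dots> = ennreal (1 / (1 + u g))"
        using elim by (simp add: ennreal_mult[symmetric])
      finally show ?case ..
    qed
  qed
  also have "\<dots> = (\<integral>\<^sup>+s. \<integral>\<^sup>+g. ennreal (if 0 < s then S g / s\<^sup>2 * exp (- ((1 + u g) * S g / s)) else 0) \<partial>\<mu> \<partial>lborel)"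
    by (rule P.Fubini'[symmetric]) measurable
  also have "\<dots> = (\<integral>\<^sup>+s. \<integral>\<^sup>+g. ennreal (exponential_density (S g) s) * ennreal (exp (- (u g * S g))) \<partial>\<mu> \<partial>lborel)"
  proof (rule nn_integral_cong_AE)
    have "AE s in lborel. s \<noteq> (0::real)"
      by (rule AE_lborel_singleton)
    then show "AE s in lborel. (\<integral>\<^sup>+g. ennreal (if 0 < s then S g / s\<^sup>2 * exp (- ((1 + u g) * S g / s)) else 0) \<partial>\<mu>)
       = (\<integral>\<^sup>+g. ennreal (exponential_density (S g) s) * ennreal (exp (- (u g * S g))) \<partial>\<mu>)"
    proof eventually_elim
      case (elim s)
      show ?case
      proof (cases "0 < s")
        case True
        define h where "h g = ennreal (S g / s * exp (- ((1 + u g) * S g)))" for g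
        have Ssc: "S (\<lambda>i\<in>{..<k}. g i / s) = S g / s" for g
          by (simp add: S_def sum_divide_distrib)
        have usc: "u (\<lambda>i\<in>{..<k}. g i / s) = u g" for g
          unfolding u_def Ssc using True by simp
        have "(\<integral>\<^sup>+g. ennreal (if 0 < s then S g / s\<^sup>2 * exp (- ((1 + u g) * S g / s)) else 0) \<partial>\<mu>)
            = (\<integral>\<^sup>+g. h (\<lambda>i\<in>{..<k}. g i / s) \<partial>\<mu>)"
          using True by (simp add: h_def Ssc usc power2_eq_square)
        also have "\<dots> = (\<integral>\<^sup>+g. ennreal (s powr (\<Sum>i<k. a i) * exp (- (s - 1) * (\<Sum>i<k. g i))) * h g \<partial>\<mu>)"
          unfolding \<mu>_def using a True
          by (intro product_gamma_law_tilt[symmetric]) (auto simp: h_def)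
        also have "\<dots> = (\<integral>\<^sup>+g. ennreal (exponential_density (S g) s) * ennreal (exp (- (u g * S g))) \<partial>\<mu>)"
        proof (rule nn_integral_cong_AE)
          show "AE g in \<mu>. ennreal (s powr (\<Sum>i<k. a i) * exp (- (s - 1) * (\<Sum>i<k. g i))) * h g
             = ennreal (exponential_density (S g) s) * ennreal (exp (- (u g * S g)))"
            using good
          proof eventually_elim
            case (elim g)
            have "s powr (\<Sum>i<k. a i) * exp (- (s - 1) * S g) * (S g / s * exp (- ((1 + u g) * S g)))
                = S g * (exp (- (s - 1) * S g) * exp (- ((1 + u g) * S g)))"
              using True by (simp add: suma)
            also have "exp (- (s - 1) * S g) * exp (- ((1 + u g) * S g)) = exp (- s * S g) * exp (- (u g * S g))"
              by (simp add: exp_add[symmetric] algebra_simps)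
            finally show ?case
              using True elim unfolding h_def S_def[symmetric]
              by (simp add: ennreal_mult[symmetric] exponential_density_def mult.assoc)
          qed
        qed
        finally show ?thesis .
      next
        case False
        then show ?thesis
          using elim by (simp add: exponential_density_def)
      qed
    qed
  qed
  also have "\<dots> = (\<integral>\<^sup>+g. \<integral>\<^sup>+s. ennreal (exponential_density (S g) s) * ennreal (exp (- (u g * S g))) \<partial>lborel \<partial>\<mu>)"
    by (rule P.Fubini') (simp add: exponential_density_def, measurable)
  also have "\<dots> = (\<integral>\<^sup>+g. ennreal (exp (- (\<Sum>i<k. c i * g i))) \<partial>\<mu>)"
  proof (rule nn_integral_cong_AE)
    show "AE g in \<mu>. (\<integral>\<^sup>+s. ennreal (exponential_density (S g) s) * ennreal (exp (- (u g * S g))) \<partial>lborel)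
        = ennreal (exp (- (\<Sum>i<k. c i * g i)))"
      using good
    proof eventually_elim
      case (elim g)
      then interpret E: prob_space "density lborel (exponential_density (S g))"
        by (intro prob_space_exponential_density) simp
      have "(\<integral>\<^sup>+s. ennreal (exponential_density (S g) s) \<partial>lborel) = 1"
        using E.emeasure_space_1 by (simp add: emeasure_density)
      then show ?case
        using elim by (subst nn_integral_multc) auto
    qed
  qed
  also have "\<dots> = (\<integral>\<^sup>+g. (\<Prod>i<k. ennreal (exp (- c i * g i))) \<partial>PiM {..<k} L)"
    unfolding muL by (intro nn_integral_cong) (simp add: prod_ennreal exp_sum[symmetric] sum_negf)
  also have "\<dots> = (\<Prod>i<k. \<integral>\<^sup>+x. ennreal (exp (- c i * x)) \<partial>L i)"
    by (subst L.product_nn_integral_prod) auto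
  also have "\<dots> = (\<Prod>i<k. ennreal ((1 + c i) powr (- a i)))"
  proof (intro prod.cong refl)
    fix i assume "i \<in> {..<k}"
    then have "i < k" by simp
    with gamma_law_Laplace[OF a c, of i i]
    show "(\<integral>\<^sup>+x. ennreal (exp (- c i * x)) \<partial>L i) = ennreal ((1 + c i) powr (- a i))"
      by (simp add: L_def)
  qed
  also have "\<dots> = ennreal (\<Prod>i<k. (1 + c i) powr (- a i))"
    by (rule prod_ennreal) simp
  finally show ?thesis .
qed

section \<open>The mean of a Dirichlet process\<close>

text \<open>
  The level sets of a simple function, numbered so that they can be fed to the finite-dimensional
  distributions of a Dirichlet process; one partition serves all \<open>Q\<close> and \<open>\<phi>\<close>.
\<close>

lemma simple_function_level_partition:
  fixes f :: "real \<Rightarrow> real"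
  assumes f: "simple_function nonneg_borel f"
  obtains k :: nat and c :: "nat \<Rightarrow> real" and C :: "nat \<Rightarrow> real set"
  where "\<And>i. i < k \<Longrightarrow> C i \<in> sets nonneg_borel" "disjoint_family_on C {..<k}"
    "(\<Union>i<k. C i) = {0..}" "\<And>i. i < k \<Longrightarrow> c i \<in> f ` {0..}"
    "\<And>Q \<phi>. sets Q = sets nonneg_borel \<Longrightarrow> prob_space Q \<Longrightarrow>
        (\<integral>x. \<phi> (f x) \<partial>Q) = (\<Sum>i<k. \<phi> (c i) * measure Q (C i))"
proof -
  have fin: "finite (f ` {0..})" and lev: "\<And>y. f -` {y} \<inter> {0..} \<in> sets nonneg_borel"
    using simple_functionD[OF f] by (auto simp: space_restrict_space)
  define k where "k = card (f ` {0..})"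
  obtain c where c: "bij_betw c {..<k} (f ` {0..})"
    using ex_bij_betw_nat_finite[OF fin] unfolding k_def lessThan_atLeast0 by auto
  define C where "C i = f -` {c i} \<inter> {0..}" for i
  have cin: "c i \<in> f ` {0..}" if "i < k" for i
    using c that by (auto simp: bij_betw_def)
  have inj: "i = j" if "c i = c j" "i < k" "j < k" for i j
    using c that by (auto simp: bij_betw_def inj_on_def)
  show thesis
  proof (rule that)
    show "C i \<in> sets nonneg_borel" if "i < k" for i
      using lev by (simp add: C_def)
    show "disjoint_family_on C {..<k}"
      using inj by (auto simp: disjoint_family_on_def C_def)
    have "\<exists>i<k. f x = c i" if "0 \<le> x" for x
    proof -
      have "f x \<in> c ` {..<k}"
        using c that by (auto simp: bij_betw_def)
      then show ?thesis by auto
    qed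
    then show "(\<Union>i<k. C i) = {0..}"
      by (auto simp: C_def Bex_def)
    show "c i \<in> f ` {0..}" if "i < k" for i
      using cin[OF that] .
    fix Q :: "real measure" and \<phi> :: "real \<Rightarrow> real"
    assume Q: "sets Q = sets nonneg_borel" "prob_space Q"
    interpret Q: prob_space Q by fact
    have spQ: "space Q = {0..}"
      using sets_eq_imp_space_eq[OF Q(1)] by (simp add: space_restrict_space)
    have CQ: "C i \<in> sets Q" for i
      using lev Q by (simp add: C_def)
    have "(\<integral>x. \<phi> (f x) \<partial>Q) = (\<integral>x. (\<Sum>i<k. \<phi> (c i) * indicator (C i) x) \<partial>Q)"
    proof (rule Bochner_Integration.integral_cong[OF refl])
      fix x assume x: "x \<in> space Q"
      then obtain j where j: "j < k" "f x = c j"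
        using c spQ by (auto simp: bij_betw_def) (metis atLeast_iff imageE image_eqI lessThan_iff)
      have "(\<Sum>i<k. \<phi> (c i) * indicator (C i) x) = (\<Sum>i<k. if i = j then \<phi> (c i) else 0)"
        using j x spQ inj by (intro sum.cong) (auto simp: C_def indicator_def)
      then show "\<phi> (f x) = (\<Sum>i<k. \<phi> (c i) * indicator (C i) x)"
        using j by simp
    qed
    also have "\<dots> = (\<Sum>i<k. \<phi> (c i) * measure Q (C i))"
      using CQ by (subst Bochner_Integration.integral_sum) (auto simp: Q.emeasure_eq_measure)
    finally show "(\<integral>x. \<phi> (f x) \<partial>Q) = (\<Sum>i<k. \<phi> (c i) * measure Q (C i))" .
  qed
qed

lemma dirichlet_process_simple_mean_transform:
  fixes f :: "real \<Rightarrow> real"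
  assumes DP: "dirichlet_process K 1 F P"
    and f: "simple_function nonneg_borel f" and pos: "\<And>x. 0 \<le> x \<Longrightarrow> 0 \<le> f x"
  shows "(\<integral>\<omega>. 1 / (1 + (\<integral>x. f x \<partial>P \<omega>)) \<partial>K) = exp (- (\<integral>x. ln (1 + f x) \<partial>F))"
    and "(\<lambda>\<omega>. \<integral>x. f x \<partial>P \<omega>) \<in> borel_measurable K"
proof -
  obtain k :: nat and c C where C: "\<And>i. i < k \<Longrightarrow> C i \<in> sets nonneg_borel" "disjoint_family_on C {..<k}"
    "(\<Union>i<k. C i) = {0..}" and c: "\<And>i. i < k \<Longrightarrow> c i \<in> f ` {0..}"
    and int: "\<And>Q \<phi>. sets Q = sets nonneg_borel \<Longrightarrow> prob_space Q \<Longrightarrow>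
        (\<integral>x. \<phi> (f x) \<partial>Q) = (\<Sum>i<k. \<phi> (c i) * measure Q (C i))"
  proof (rule simple_function_level_partition[OF f], goal_cases)
    case (1 k c C)
    show ?case using 1(2-6) by (rule 1(1))
  qed
  have c0: "0 \<le> c i" if i: "i < k" for i
  proof -
    obtain x where "0 \<le> x" "c i = f x"
      using c[OF i] by auto
    then show ?thesis
      using pos by simp
  qed
  interpret K: prob_space K using DP by (simp add: dirichlet_process_def)
  have Pm[measurable]: "P \<in> measurable K (prob_algebra nonneg_borel)"
    and F: "sets F = sets nonneg_borel" "prob_space F"
    using DP by (auto simp: dirichlet_process_def space_prob_algebra)
  have PP: "sets (P \<omega>) = sets nonneg_borel" "prob_space (P \<omega>)" if "\<omega> \<in> space K" for \<omega>
    using measurable_space[OF Pm that] by (auto simp: space_prob_algebra)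
  interpret F: prob_space F by fact
  have Cm[measurable]: "i < k \<Longrightarrow> (\<lambda>\<omega>. measure (P \<omega>) (C i)) \<in> borel_measurable K" for i
    using C(1)[of i] by measurable
  have mean: "(\<integral>x. f x \<partial>P \<omega>) = (\<Sum>i<k. c i * measure (P \<omega>) (C i))" if "\<omega> \<in> space K" for \<omega>
    using int[OF PP[OF that], of "\<lambda>x. x"] by simp
  have mean_m: "(\<lambda>\<omega>. \<Sum>i<k. c i * measure (P \<omega>) (C i)) \<in> borel_measurable K"
    by measurable
  then show meas: "(\<lambda>\<omega>. \<integral>x. f x \<partial>P \<omega>) \<in> borel_measurable K"
    by (simp cong: measurable_cong add: mean)
  have spF: "space F = {0..}"
    using sets_eq_imp_space_eq[OF F(1)] by (simp add: space_restrict_space)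
  have suma: "(\<Sum>i<k. measure F (C i)) = 1"
  proof -
    have "(\<Sum>i<k. measure F (C i)) = measure F (\<Union>i<k. C i)"
      using C F by (intro F.finite_measure_finite_Union[symmetric]) auto
    then show ?thesis
      using C(3) spF F.prob_space by simp
  qed
  have mean0: "0 \<le> (\<Sum>i<k. c i * measure (P \<omega>) (C i))" for \<omega>
    using c0 by (intro sum_nonneg) auto
  have law: "distr K (\<Pi>\<^sub>M i\<in>{..<k}. borel) (\<lambda>\<omega>. \<lambda>i\<in>{..<k}. measure (P \<omega>) (C i)) = dirichlet_law k (\<lambda>i. measure F (C i))"
    using DP C unfolding dirichlet_process_def by auto
  have "(\<integral>\<^sup>+\<omega>. ennreal (1 / (1 + (\<integral>x. f x \<partial>P \<omega>))) \<partial>K)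
      = (\<integral>\<^sup>+\<omega>. ennreal (1 / (1 + (\<Sum>i<k. c i * measure (P \<omega>) (C i)))) \<partial>K)"
    by (intro nn_integral_cong) (simp add: mean)
  also have "\<dots> = (\<integral>\<^sup>+p. ennreal (1 / (1 + (\<Sum>i<k. c i * p i)))
       \<partial>distr K (\<Pi>\<^sub>M i\<in>{..<k}. borel) (\<lambda>\<omega>. \<lambda>i\<in>{..<k}. measure (P \<omega>) (C i)))"
    by (subst nn_integral_distr) (auto intro!: nn_integral_cong measurable_restrict)
  also have "\<dots> = ennreal (\<Prod>i<k. (1 + c i) powr (- measure F (C i)))"
    unfolding law using suma c0 by (intro nn_integral_dirichlet_law) auto
  also have "(\<Prod>i<k. (1 + c i) powr (- measure F (C i))) = exp (- (\<Sum>i<k. ln (1 + c i) * measure F (C i)))"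
    unfolding sum_negf[symmetric] exp_sum[OF finite_lessThan]
  proof (intro prod.cong refl)
    fix i assume "i \<in> {..<k}"
    then have "0 < 1 + c i" using c0[of i] by auto
    then show "(1 + c i) powr (- measure F (C i)) = exp (- (ln (1 + c i) * measure F (C i)))"
      by (simp add: powr_def mult.commute)
  qed
  also have "(\<Sum>i<k. ln (1 + c i) * measure F (C i)) = (\<integral>x. ln (1 + f x) \<partial>F)"
    using int[OF F, of "\<lambda>y. ln (1 + y)"] by simp
  finally have nn: "(\<integral>\<^sup>+\<omega>. ennreal (1 / (1 + (\<integral>x. f x \<partial>P \<omega>))) \<partial>K) = ennreal (exp (- (\<integral>x. ln (1 + f x) \<partial>F)))" .
  show "(\<integral>\<omega>. 1 / (1 + (\<integral>x. f x \<partial>P \<omega>)) \<partial>K) = exp (- (\<integral>x. ln (1 + f x) \<partial>F))"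
    using meas mean0
    by (subst integral_eq_nn_integral) (auto simp: nn mean intro!: AE_I2)
qed

text \<open>
  The Markov-Krein identity for the mean itself, by monotone approximation. The approximation is first carried out for the
  mean \<open>R\<close> with values in \<open>[0, \<infinity>]\<close>, with \<open>1 / (1 + l * \<infinity>) = 0\<close>; this is the function \<open>J l\<close>
  in the proof. Since \<open>J l R\<close> tends to the indicator of \<open>R < \<infinity>\<close> as \<open>l \<rightarrow> 0\<close>, and its expectation
  tends to \<open>exp 0 = 1\<close>, the mean is almost surely finite. Only then does the identity transfer to the
  real-valued \<open>random_mean\<close>.
\<close>

lemma dirichlet_mean_transform:
  assumes DP: "dirichlet_process K 1 F P"
    and fin: "\<And>l. 0 \<le> l \<Longrightarrow> integrable F (\<lambda>x. ln (1 + l * x))"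
  shows "random_mean P \<in> borel_measurable K"
    and "AE \<omega> in K. integrable (P \<omega>) (\<lambda>x. x)"
    and "\<And>l. 0 \<le> l \<Longrightarrow> (\<integral>\<omega>. 1 / (1 + l * random_mean P \<omega>) \<partial>K) = exp (- psi F l)"
proof -
  interpret K: prob_space K using DP by (simp add: dirichlet_process_def)
  have Pm[measurable]: "P \<in> measurable K (prob_algebra nonneg_borel)"
    and F: "sets F = sets nonneg_borel" "prob_space F"
    using DP by (auto simp: dirichlet_process_def space_prob_algebra)
  have PP: "sets (P \<omega>) = sets nonneg_borel" "prob_space (P \<omega>)" if "\<omega> \<in> space K" for \<omega>
    using measurable_space[OF Pm that] by (auto simp: space_prob_algebra)
  have spP: "space (P \<omega>) = {0..}" if "\<omega> \<in> space K" for \<omega>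
    using sets_eq_imp_space_eq[OF PP(1)[OF that]] by (simp add: space_restrict_space)
  interpret F: prob_space F by fact
  have spF: "space F = {0..}"
    using sets_eq_imp_space_eq[OF F(1)] by (simp add: space_restrict_space)
  define R where "R \<omega> = (\<integral>\<^sup>+x. ennreal x \<partial>P \<omega>)" for \<omega>
  have id_meas: "(\<lambda>x. x) \<in> borel_measurable nonneg_borel"
    by (intro measurable_restrict_space1) simp
  have R_meas[measurable]: "R \<in> borel_measurable K"
    unfolding R_def
    by (rule measurable_compose[OF measurable_prob_algebraD[OF Pm] nn_integral_measurable_subprob_algebra])
      (use id_meas in measurable)
  have mean: "random_mean P \<omega> = enn2real (R \<omega>)" if "\<omega> \<in> space K" for \<omega>
    unfolding random_mean_def R_def using id_meas PP(1)[OF that] spP[OF that]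
    by (intro integral_eq_nn_integral) (auto cong: measurable_cong_sets intro!: AE_I2)
  show mean_meas: "random_mean P \<in> borel_measurable K"
    using mean by (subst measurable_cong[OF mean]) measurable
  have u: "(\<lambda>x. ennreal x) \<in> borel_measurable nonneg_borel"
    using id_meas by measurable
  obtain f where f: "\<And>i. simple_function nonneg_borel (f i)" "incseq f" "\<And>i x. f i x < top"
      "\<And>x. (SUP i. f i x) = ennreal x"
    using borel_measurable_implies_simple_function_sequence'[OF u] by blast
  define g where "g i x = enn2real (f i x)" for i x
  have eg: "ennreal (g i x) = f i x" for i x
    using f(3) by (simp add: g_def)
  have g0: "0 \<le> g i x" for i x by (simp add: g_def)
  have g_simple: "simple_function nonneg_borel (\<lambda>x. l * g i x)" for i l
    unfolding g_def using f(1) by (rule simple_function_compose1)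
  have flim: "(\<lambda>i. f i x) \<longlonglongrightarrow> ennreal x" for x
    using LIMSEQ_SUP[of "\<lambda>i. f i x"] f(2,4) by (auto simp: incseq_def le_fun_def)
  have glim: "(\<lambda>i. g i x) \<longlonglongrightarrow> x" if "0 \<le> x" for x
    unfolding g_def using tendsto_enn2real[OF flim that] .
  have gle: "g i x \<le> x" if "0 \<le> x" for i x
  proof -
    have "f i x \<le> ennreal x" unfolding f(4)[symmetric] by (rule SUP_upper) simp
    then show ?thesis using that by (simp add: eg[symmetric])
  qed
  have g_meas: "g i \<in> borel_measurable nonneg_borel" for i
    using g_simple[of 1 i] borel_measurable_simple_function by fastforce
  define m where "m i \<omega> = (\<integral>x. g i x \<partial>P \<omega>)" for i \<omega>
  have m0: "0 \<le> m i \<omega>" for i \<omega>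
    unfolding m_def by (intro integral_nonneg_AE AE_I2 g0)
  have m_meas[measurable]: "m i \<in> borel_measurable K" for i
    using dirichlet_process_simple_mean_transform(2)[OF DP g_simple[of 1 i]] g0 by (simp add: m_def[abs_def])
  have mlim: "(\<lambda>i. ennreal (m i \<omega>)) \<longlonglongrightarrow> R \<omega>" if \<omega>: "\<omega> \<in> space K" for \<omega>
  proof -
    interpret P: prob_space "P \<omega>" by (rule PP[OF \<omega>])
    have gP: "g i \<in> borel_measurable (P \<omega>)" "f i \<in> borel_measurable (P \<omega>)" for i
      using g_meas borel_measurable_simple_function[OF f(1)] PP(1)[OF \<omega>] by (simp_all cong: measurable_cong_sets)
    have "ennreal (m i \<omega>) = (\<integral>\<^sup>+x. f i x \<partial>P \<omega>)" for i
    proof -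
      have "finite (g i ` {0..})"
        using simple_functionD(1)[OF g_simple[of 1 i]] by (simp add: space_restrict_space)
      then have "bdd_above (g i ` {0..})" by (rule bdd_above_finite)
      then obtain B where "\<And>x. 0 \<le> x \<Longrightarrow> g i x \<le> B" by (auto simp: bdd_above_def)
      then have "integrable (P \<omega>) (g i)"
        using gP g0 spP[OF \<omega>] by (intro P.integrable_const_bound[where B=B]) (auto intro!: AE_I2)
      then show ?thesis
        unfolding m_def using g0 by (subst nn_integral_eq_integral[symmetric]) (auto simp: eg)
    qed
    then show ?thesis
      unfolding R_def using nn_integral_LIMSEQ[OF f(2) gP(2) flim] by simp
  qed
  define J where "J l r = (if r = \<top> then 0 else 1 / (1 + l * enn2real r))" for l :: real and r
  have J_meas[measurable]: "J l \<in> borel_measurable borel" for l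
    unfolding J_def by measurable
  have J01: "0 \<le> J l r" "J l r \<le> 1" if "0 \<le> l" for l r
    using that by (auto simp: J_def divide_le_eq add_nonneg_pos intro!: divide_nonneg_pos add_pos_nonneg)
  have Jlim: "(\<lambda>i. 1 / (1 + l * m i \<omega>)) \<longlonglongrightarrow> J l (R \<omega>)" if \<omega>: "\<omega> \<in> space K" and l: "0 < l" for l \<omega>
  proof (cases "R \<omega> = \<top>")
    case True
    then have "filterlim (\<lambda>i. m i \<omega>) at_top sequentially"
      using mlim[OF \<omega>] by (simp add: ennreal_tendsto_top_eq_at_top)
    then have "(\<lambda>i. 1 / (1 + l * m i \<omega>)) \<longlonglongrightarrow> 0"
      using l by (intro tendsto_divide_0[OF tendsto_const] filterlim_at_top_imp_at_infinity
        filterlim_tendsto_add_at_top[OF tendsto_const] filterlim_tendsto_pos_mult_at_top[OF tendsto_const])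
    then show ?thesis using True by (simp add: J_def)
  next
    case False
    then have "(\<lambda>i. enn2real (ennreal (m i \<omega>))) \<longlonglongrightarrow> enn2real (R \<omega>)"
      using mlim[OF \<omega>] by (intro tendsto_enn2real) (auto simp: less_top)
    then have "(\<lambda>i. m i \<omega>) \<longlonglongrightarrow> enn2real (R \<omega>)"
      using m0 by simp
    then show ?thesis
      using False l by (auto simp: J_def intro!: tendsto_intros) (smt (verit) enn2real_nonneg mult_nonneg_nonneg)
  qed
  have main: "(\<integral>\<omega>. J l (R \<omega>) \<partial>K) = exp (- psi F l)" if l: "0 < l" for l
  proof (rule LIMSEQ_unique)
    show "(\<lambda>i. \<integral>\<omega>. 1 / (1 + l * m i \<omega>) \<partial>K) \<longlonglongrightarrow> (\<integral>\<omega>. J l (R \<omega>) \<partial>K)"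
      using l m0 Jlim by (intro integral_dominated_convergence[where w="\<lambda>_. 1"])
        (auto intro!: AE_I2 simp: divide_le_eq add_nonneg_pos abs_of_nonneg add_pos_nonneg)
    have "(\<integral>\<omega>. 1 / (1 + l * m i \<omega>) \<partial>K) = exp (- (\<integral>x. ln (1 + l * g i x) \<partial>F))" for i
      using dirichlet_process_simple_mean_transform(1)[OF DP g_simple[of l i]] l g0 by (simp add: m_def)
    moreover have "(\<lambda>i. exp (- (\<integral>x. ln (1 + l * g i x) \<partial>F))) \<longlonglongrightarrow> exp (- psi F l)"
      unfolding psi_def
    proof (intro tendsto_exp tendsto_minus integral_dominated_convergence[where w="\<lambda>x. ln (1 + l * x)"])
      show "integrable F (\<lambda>x. ln (1 + l * x))" using fin l by simp
      show "(\<lambda>x. ln (1 + l * x)) \<in> borel_measurable F"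
        using fin[of l] l by auto
      show "(\<lambda>x. ln (1 + l * g i x)) \<in> borel_measurable F" for i
        using g_meas[of i] F by (simp cong: measurable_cong_sets)
      show "AE x in F. (\<lambda>i. ln (1 + l * g i x)) \<longlonglongrightarrow> ln (1 + l * x)"
      proof (rule AE_I2)
        fix x assume "x \<in> space F"
        then have "0 \<le> x" using spF by simp
        moreover from this have "0 < 1 + l * x" using l by (simp add: add_pos_nonneg)
        ultimately show "(\<lambda>i. ln (1 + l * g i x)) \<longlonglongrightarrow> ln (1 + l * x)"
          by (intro tendsto_intros glim) auto
      qed
      show "AE x in F. norm (ln (1 + l * g i x)) \<le> ln (1 + l * x)" for i
        using spF g0 gle l by (auto intro!: AE_I2 simp: add_pos_nonneg)
    qed
    ultimately show "(\<lambda>i. \<integral>\<omega>. 1 / (1 + l * m i \<omega>) \<partial>K) \<longlonglongrightarrow> exp (- psi F l)"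
      by simp
  qed
  have finite_mean: "AE \<omega> in K. R \<omega> \<noteq> \<top>"
  proof -
    let ?l = "\<lambda>n. 1 / real (Suc n)"
    have l0: "?l \<longlonglongrightarrow> 0" by (rule LIMSEQ_Suc[OF lim_1_over_n])
    have "(\<lambda>n. \<integral>\<omega>. J (?l n) (R \<omega>) \<partial>K) \<longlonglongrightarrow> (\<integral>\<omega>. indicator {r. r \<noteq> \<top>} (R \<omega>) \<partial>K)"
    proof (rule integral_dominated_convergence[where w="\<lambda>_. 1"])
      show "AE \<omega> in K. (\<lambda>n. J (?l n) (R \<omega>)) \<longlonglongrightarrow> indicator {r. r \<noteq> \<top>} (R \<omega>)"
      proof (rule AE_I2)
        fix \<omega> assume "\<omega> \<in> space K"
        have "(\<lambda>n. 1 / (1 + ?l n * enn2real (R \<omega>))) \<longlonglongrightarrow> 1 / (1 + 0 * enn2real (R \<omega>))"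
          using l0 by (intro tendsto_intros) auto
        then show "(\<lambda>n. J (?l n) (R \<omega>)) \<longlonglongrightarrow> indicator {r. r \<noteq> \<top>} (R \<omega>)"
          by (cases "R \<omega> = \<top>") (simp_all add: J_def)
      qed
      show "AE \<omega> in K. norm (J (?l n) (R \<omega>)) \<le> 1" for n
        using J01[of "?l n"] by (intro AE_I2) simp
    qed auto
    moreover have "(\<lambda>n. \<integral>\<omega>. J (?l n) (R \<omega>) \<partial>K) \<longlonglongrightarrow> 1"
    proof -
      have "(\<lambda>n. psi F (?l n)) \<longlonglongrightarrow> (\<integral>x. 0 \<partial>F)"
        unfolding psi_def
      proof (rule integral_dominated_convergence[where w="\<lambda>x. ln (1 + 1 * x)"])
        show "integrable F (\<lambda>x. ln (1 + 1 * x))" by (rule fin) simp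
        show "(\<lambda>x. ln (1 + ?l n * x)) \<in> borel_measurable F" for n
          by (rule borel_measurable_integrable[OF fin]) simp
        show "AE x in F. (\<lambda>n. ln (1 + ?l n * x)) \<longlonglongrightarrow> 0"
        proof (rule AE_I2)
          fix x
          have "(\<lambda>n. ln (1 + ?l n * x)) \<longlonglongrightarrow> ln (1 + 0 * x)"
            using l0 by (intro tendsto_intros) auto
          then show "(\<lambda>n. ln (1 + ?l n * x)) \<longlonglongrightarrow> 0" by simp
        qed
        show "AE x in F. norm (ln (1 + ?l n * x)) \<le> ln (1 + 1 * x)" for n
        proof (rule AE_I2)
          fix x assume "x \<in> space F"
          then have x: "0 \<le> x" using spF by simp
          then have "?l n * x \<le> 1 * x" by (intro mult_right_mono) auto
          moreover have "0 \<le> ?l n * x" using x by simp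
          ultimately show "norm (ln (1 + ?l n * x)) \<le> ln (1 + 1 * x)" by simp
        qed
      qed simp
      then have "(\<lambda>n. exp (- psi F (?l n))) \<longlonglongrightarrow> exp (- 0)"
        by (intro tendsto_exp tendsto_minus) simp
      then show ?thesis by (simp add: main)
    qed
    ultimately have "(\<integral>\<omega>. indicator {r. r \<noteq> \<top>} (R \<omega>) \<partial>K) = (1::real)"
      by (rule LIMSEQ_unique)
    moreover have "(\<integral>\<omega>. indicator {r. r \<noteq> \<top>} (R \<omega>) \<partial>K) = (\<integral>\<omega>. indicator {\<omega>\<in>space K. R \<omega> \<noteq> \<top>} \<omega> \<partial>K :: real)"
      by (intro Bochner_Integration.integral_cong) (auto simp: indicator_def)
    ultimately have "K.prob {\<omega>\<in>space K. R \<omega> \<noteq> \<top>} = 1"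
      by simp
    then have "AE \<omega> in K. \<omega> \<in> {\<omega>\<in>space K. R \<omega> \<noteq> \<top>}"
      by (subst (asm) K.prob_eq_1) auto
    then show ?thesis by eventually_elim simp
  qed
  show "AE \<omega> in K. integrable (P \<omega>) (\<lambda>x. x)"
    using finite_mean AE_space
  proof eventually_elim
    case (elim \<omega>)
    then show ?case
      using id_meas PP(1) spP
      by (intro integrableI_nonneg) (auto simp: R_def less_top cong: measurable_cong_sets intro!: AE_I2)
  qed
  show "(\<integral>\<omega>. 1 / (1 + l * random_mean P \<omega>) \<partial>K) = exp (- psi F l)" if l: "0 \<le> l" for l
  proof (cases "l = 0")
    case True
    then show ?thesis by (simp add: psi_def K.prob_space)
  next
    case False
    have "(\<integral>\<omega>. 1 / (1 + l * random_mean P \<omega>) \<partial>K) = (\<integral>\<omega>. J l (R \<omega>) \<partial>K)"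
    proof (rule integral_cong_AE)
      show "AE \<omega> in K. 1 / (1 + l * random_mean P \<omega>) = J l (R \<omega>)"
        using finite_mean AE_space by eventually_elim (simp add: J_def mean)
    qed (use mean_meas in auto)
    then show ?thesis
      using main False l by simp
  qed
qed

section \<open>Uniqueness theorems for transforms\<close>

text \<open>
  For a variable with values in \<open>[0, 1]\<close> the characteristic function is the sum of its moment
  series, so the claim reduces to uniqueness for characteristic functions.
\<close>

lemma distr_eq_of_moments_eq:
  fixes X :: "'a \<Rightarrow> real" and Y :: "'b \<Rightarrow> real"
  assumes M: "prob_space M" and N: "prob_space N"
    and X: "X \<in> borel_measurable M" and Y: "Y \<in> borel_measurable N"
    and bX: "AE x in M. 0 \<le> X x \<and> X x \<le> 1"
    and bY: "AE x in N. 0 \<le> Y x \<and> Y x \<le> 1"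
    and eq: "\<And>n. (\<integral>x. X x ^ n \<partial>M) = (\<integral>x. Y x ^ n \<partial>N)"
  shows "distr M borel X = distr N borel Y"
proof -
  have approx: "(\<lambda>n. \<Sum>k\<le>n. ((\<i> * t) ^ k / fact k) * complex_of_real (\<integral>x. Z x ^ k \<partial>L)) \<longlonglongrightarrow> char (distr L borel Z) t"
    if L: "prob_space L" and Z: "Z \<in> borel_measurable L"
      and b: "AE x in L. 0 \<le> Z x \<and> Z x \<le> (1::real)" for L :: "'c measure" and Z t
  proof -
    interpret L: prob_space L by fact
    interpret D: real_distribution "distr L borel Z"
      using Z by (rule L.real_distribution_distr)
    have int: "integrable L (\<lambda>x. Z x ^ k)" for k
      using Z by (intro L.integrable_const_bound[where B=1] eventually_mono[OF b]) (auto simp: power_le_one)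
    have intD: "integrable (distr L borel Z) (\<lambda>x. x ^ k)" for k
      using int[of k] Z by (subst integrable_distr_eq) auto
    have bound: "cmod (char (distr L borel Z) t - (\<Sum>k\<le>n. ((\<i> * t) ^ k / fact k) * complex_of_real (\<integral>x. Z x ^ k \<partial>L)))
        \<le> 2 * (\<bar>t\<bar> ^ n / fact n)" for n
    proof -
      have "(\<integral>x. \<bar>x\<bar> ^ n \<partial>distr L borel Z) = (\<integral>x. \<bar>Z x\<bar> ^ n \<partial>L)"
        using Z by (subst integral_distr) auto
      also have "\<dots> \<le> 1"
        using Z by (intro L.integral_le_const L.integrable_const_bound[where B=1] eventually_mono[OF b])
           (auto simp: power_le_one)
      finally have le1: "(2 * \<bar>t\<bar> ^ n / fact n) * (\<integral>x. \<bar>x\<bar> ^ n \<partial>distr L borel Z) \<le> (2 * \<bar>t\<bar> ^ n / fact n)"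
        by (intro mult_left_le) auto
      have "cmod (char (distr L borel Z) t - (\<Sum>k\<le>n. ((\<i> * t) ^ k / fact k) * complex_of_real (\<integral>x. Z x ^ k \<partial>L)))
          \<le> (2 * \<bar>t\<bar> ^ n / fact n) * (\<integral>x. \<bar>x\<bar> ^ n \<partial>distr L borel Z)"
        using D.char_approx1[of n t] intD Z by (simp add: integral_distr)
      with le1 show ?thesis
        by simp
    qed
    have "(\<lambda>n. 2 * (\<bar>t\<bar> ^ n / fact n)) \<longlonglongrightarrow> 0"
      using summable_LIMSEQ_zero[OF summable_exp_generic[of "\<bar>t\<bar>"]]
      by (intro tendsto_mult_right_zero) (simp add: divide_inverse mult.commute scaleR_conv_of_real)
    then have "(\<lambda>n. char (distr L borel Z) t - (\<Sum>k\<le>n. ((\<i> * t) ^ k / fact k) * complex_of_real (\<integral>x. Z x ^ k \<partial>L))) \<longlonglongrightarrow> 0"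
      by (rule Lim_null_comparison[rotated]) (use bound in simp)
    from tendsto_diff[OF tendsto_const this, of "char (distr L borel Z) t"] show ?thesis
      by simp
  qed
  have "char (distr M borel X) t = char (distr N borel Y) t" for t
    using approx[OF M X bX, of t] approx[OF N Y bY, of t] unfolding eq
    by (rule LIMSEQ_unique)
  then show ?thesis
    using X Y M N
    by (intro Levy_uniqueness prob_space.real_distribution_distr) auto
qed

text \<open>
  The moments of \<open>exp (- X)\<close> are the values of the Laplace transform at the natural numbers.
\<close>

lemma distr_eq_of_Laplace_eq:
  fixes X :: "'a \<Rightarrow> real" and Y :: "'b \<Rightarrow> real"
  assumes M: "prob_space M" and N: "prob_space N"
    and X[measurable]: "X \<in> borel_measurable M" and Y[measurable]: "Y \<in> borel_measurable N"
    and bX: "AE x in M. 0 \<le> X x" and bY: "AE x in N. 0 \<le> Y x"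
    and eq: "\<And>l. 0 \<le> l \<Longrightarrow> (\<integral>x. exp (- l * X x) \<partial>M) = (\<integral>x. exp (- l * Y x) \<partial>N)"
  shows "distr M borel X = distr N borel Y"
proof -
  have "distr M borel (\<lambda>x. exp (- X x)) = distr N borel (\<lambda>x. exp (- Y x))"
  proof (rule distr_eq_of_moments_eq[OF M N])
    show "AE x in M. 0 \<le> exp (- X x) \<and> exp (- X x) \<le> 1" "AE x in N. 0 \<le> exp (- Y x) \<and> exp (- Y x) \<le> 1"
      using bX bY by auto
    show "(\<integral>x. exp (- X x) ^ n \<partial>M) = (\<integral>x. exp (- Y x) ^ n \<partial>N)" for n
      using eq[of "real n"] by (simp add: exp_of_nat_mult[symmetric])
  qed auto
  then have "distr (distr M borel (\<lambda>x. exp (- X x))) borel (\<lambda>y. - ln y)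
           = distr (distr N borel (\<lambda>x. exp (- Y x))) borel (\<lambda>y. - ln y)"
    by simp
  then show ?thesis
    by (simp add: distr_distr comp_def)
qed

lemma powser_coeff_unique:
  fixes a b :: "nat \<Rightarrow> real"
  assumes a: "\<And>n. \<bar>a n\<bar> \<le> 1" and b: "\<And>n. \<bar>b n\<bar> \<le> 1"
    and eq: "\<And>d. \<bar>d\<bar> < 1 \<Longrightarrow> (\<Sum>n. a n * d ^ n) = (\<Sum>n. b n * d ^ n)"
  shows "a = b"
proof -
  have summ: "summable (\<lambda>n. c n * d ^ n)" if "\<And>n. \<bar>c n\<bar> \<le> 1" "\<bar>d\<bar> < 1" for c :: "nat \<Rightarrow> real" and d
    by (rule summable_comparison_test'[where g="\<lambda>n. \<bar>d\<bar> ^ n"])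
       (use that in \<open>auto simp: abs_mult power_abs mult_left_le_one_le\<close>)
  have sums: "(\<lambda>n. (a n - b n) * d ^ n) sums 0" if "\<bar>d\<bar> < 1" for d
    using sums_diff[OF summable_sums[OF summ[of a, OF a that]] summable_sums[OF summ[of b, OF b that]]] eq[OF that]
    by (simp add: left_diff_distrib)
  have pos: "a m - b m = 0" if m: "m > 0" for m
  proof (rule ccontr)
    assume nz: "a m - b m \<noteq> 0"
    show False
    proof (rule powser_0_nonzero[of 1 0 "\<lambda>n. a n - b n" "\<lambda>_. 0" m])
      fix s :: real assume s: "0 < s" "\<And>z::real. z \<in> cball 0 s - {0} \<Longrightarrow> (0::real) \<noteq> 0"
      show False
        using s(1) s(2)[of s] by simp
    qed (use sums nz m in auto)
  qed
  moreover have "a 0 - b 0 = 0"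
    using sums[of 0] by simp
  ultimately have "a m = b m" for m
    by (cases "m = 0") auto
  then show ?thesis ..
qed

text \<open>
  With \<open>U = X / (1 + X)\<close> and \<open>l = 1 - d\<close> one has \<open>1 / (1 + l X) = (1 - U) / (1 - d U)\<close>, so the
  transform is the power series in \<open>d\<close> with coefficients \<open>\<^bold>E ((1 - U) U\<^sup>n)\<close>. These telescope to the
  moments of \<open>U\<close>, starting from \<open>\<^bold>E 1 = 1\<close>, and the moments determine the law of \<open>U\<close>.
\<close>

lemma distr_eq_of_Stieltjes_eq:
  fixes X :: "'a \<Rightarrow> real" and Y :: "'b \<Rightarrow> real"
  assumes M: "prob_space M" and N: "prob_space N"
    and X[measurable]: "X \<in> borel_measurable M" and Y[measurable]: "Y \<in> borel_measurable N"
    and bX: "AE x in M. 0 \<le> X x" and bY: "AE x in N. 0 \<le> Y x"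
    and eq: "\<And>l. 0 < l \<Longrightarrow> (\<integral>x. 1 / (1 + l * X x) \<partial>M) = (\<integral>x. 1 / (1 + l * Y x) \<partial>N)"
  shows "distr M borel X = distr N borel Y"
proof -
  define U where "U = (\<lambda>x::real. x / (1 + x))"
  have U[measurable]: "U \<in> borel_measurable borel"
    by (auto simp: U_def)
  have Ub: "0 \<le> U x" "U x < 1" if "0 \<le> x" for x
    using that by (auto simp: U_def)
  have abs_lt: "\<bar>u * d\<bar> < 1" if "0 \<le> u" "u < 1" "\<bar>d\<bar> < 1" for u d :: real
    using that mult_left_le_one_le[of "\<bar>d\<bar>" u] by (simp add: abs_mult)
  have series: "(\<integral>x. 1 / (1 + (1 - d) * Z x) \<partial>L) = (\<Sum>n. (\<integral>x. (1 - U (Z x)) * U (Z x) ^ n \<partial>L) * d ^ n)"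
   and bnd: "\<bar>\<integral>x. (1 - U (Z x)) * U (Z x) ^ n \<partial>L\<bar> \<le> 1"
   and tele: "(\<integral>x. U (Z x) ^ Suc n \<partial>L) = (\<integral>x. U (Z x) ^ n \<partial>L) - (\<integral>x. (1 - U (Z x)) * U (Z x) ^ n \<partial>L)"
    if L: "prob_space L" and Z[measurable]: "Z \<in> borel_measurable L" and b: "AE x in L. 0 \<le> Z x" and d: "\<bar>d\<bar> < 1"
    for L :: "'c measure" and Z d n
  proof -
    interpret L: prob_space L by fact
    have UZ: "AE x in L. 0 \<le> U (Z x) \<and> U (Z x) < 1"
      using b by eventually_elim (use Ub in auto)
    have int: "integrable L (\<lambda>x. U (Z x) ^ n)" for n
      by (intro L.integrable_const_bound[where B=1] eventually_mono[OF UZ]) (auto simp: power_le_one)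
    have int': "integrable L (\<lambda>x. (1 - U (Z x)) * U (Z x) ^ n)" for n
      by (intro L.integrable_const_bound[where B=1] eventually_mono[OF UZ]) (auto simp: power_le_one abs_mult mult_le_one)
    show "(\<integral>x. U (Z x) ^ Suc n \<partial>L) = (\<integral>x. U (Z x) ^ n \<partial>L) - (\<integral>x. (1 - U (Z x)) * U (Z x) ^ n \<partial>L)"
      by (subst Bochner_Integration.integral_diff[symmetric]) (use int[of n] int'[of n] in \<open>auto simp: left_diff_distrib\<close>)
    have b1: "(\<integral>x. \<bar>(1 - U (Z x)) * U (Z x) ^ n\<bar> \<partial>L) \<le> 1" for n
      by (intro L.integral_le_const integrable_abs int' eventually_mono[OF UZ])
        (auto simp: power_le_one abs_mult mult_le_one)
    show "\<bar>\<integral>x. (1 - U (Z x)) * U (Z x) ^ n \<partial>L\<bar> \<le> 1"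
      by (rule order_trans[OF integral_abs_bound b1])
    have "(\<lambda>n. \<integral>x. (1 - U (Z x)) * U (Z x) ^ n * d ^ n \<partial>L) sums (\<integral>x. (\<Sum>n. (1 - U (Z x)) * U (Z x) ^ n * d ^ n) \<partial>L)"
    proof (rule sums_integral)
      show "AE x in L. summable (\<lambda>n. norm ((1 - U (Z x)) * U (Z x) ^ n * d ^ n))"
        using UZ
      proof eventually_elim
        fix x assume "0 \<le> U (Z x) \<and> U (Z x) < 1"
        then have "summable (\<lambda>n. \<bar>1 - U (Z x)\<bar> * (U (Z x) * \<bar>d\<bar>) ^ n)"
          using abs_lt[of "U (Z x)" "\<bar>d\<bar>"] d by (intro summable_mult summable_geometric) auto
        then show "summable (\<lambda>n. norm ((1 - U (Z x)) * U (Z x) ^ n * d ^ n))"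
          using \<open>0 \<le> U (Z x) \<and> U (Z x) < 1\<close> by (simp add: abs_mult power_mult_distrib power_abs mult.assoc)
      qed
      show "summable (\<lambda>n. \<integral>x. norm ((1 - U (Z x)) * U (Z x) ^ n * d ^ n) \<partial>L)"
      proof (rule summable_comparison_test'[where g="\<lambda>n. \<bar>d\<bar> ^ n"])
        show "summable (\<lambda>n. \<bar>d\<bar> ^ n)" using d by simp
        show "norm (\<integral>x. norm ((1 - U (Z x)) * U (Z x) ^ n * d ^ n) \<partial>L) \<le> \<bar>d\<bar> ^ n" for n
        proof -
          have "norm (\<integral>x. norm ((1 - U (Z x)) * U (Z x) ^ n * d ^ n) \<partial>L) = (\<integral>x. \<bar>(1 - U (Z x)) * U (Z x) ^ n\<bar> \<partial>L) * \<bar>d\<bar> ^ n"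
            by (simp add: abs_mult power_abs)
          then show ?thesis
            using mult_right_mono[OF b1[of n], of "\<bar>d\<bar> ^ n"] by simp
        qed
      qed
    qed (use int' in auto)
    then have "(\<Sum>n. (\<integral>x. (1 - U (Z x)) * U (Z x) ^ n \<partial>L) * d ^ n) = (\<integral>x. (\<Sum>n. (1 - U (Z x)) * U (Z x) ^ n * d ^ n) \<partial>L)"
      by (simp add: sums_iff)
    also have "\<dots> = (\<integral>x. 1 / (1 + (1 - d) * Z x) \<partial>L)"
    proof (rule integral_cong_AE)
      show "AE x in L. (\<Sum>n. (1 - U (Z x)) * U (Z x) ^ n * d ^ n) = 1 / (1 + (1 - d) * Z x)"
        using b
      proof eventually_elim
        fix x assume Zx: "0 \<le> Z x"
        have lt: "\<bar>U (Z x) * d\<bar> < 1"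
          using Ub[OF Zx] d by (intro abs_lt) auto
        have "(\<Sum>n. (1 - U (Z x)) * U (Z x) ^ n * d ^ n) = (1 - U (Z x)) * (\<Sum>n. (U (Z x) * d) ^ n)"
          using lt by (subst suminf_mult[symmetric]) (auto simp: power_mult_distrib mult.assoc summable_geometric intro!: arg_cong[of _ _ suminf])
        also have "\<dots> = (1 - U (Z x)) * (1 / (1 - U (Z x) * d))"
          using lt by (subst suminf_geometric) auto
        also have "\<dots> = 1 / (1 + (1 - d) * Z x)"
        proof -
          have p: "1 + (1 - d) * Z x > 0" "1 + Z x > 0"
            using Zx d by (auto intro: add_pos_nonneg)
          have "1 - U (Z x) = 1 / (1 + Z x)" "1 - U (Z x) * d = (1 + (1 - d) * Z x) / (1 + Z x)"
            using p by (auto simp: U_def field_simps)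
          then show ?thesis using p by simp
        qed
        finally show "(\<Sum>n. (1 - U (Z x)) * U (Z x) ^ n * d ^ n) = 1 / (1 + (1 - d) * Z x)" .
      qed
    qed auto
    finally show "(\<integral>x. 1 / (1 + (1 - d) * Z x) \<partial>L) = (\<Sum>n. (\<integral>x. (1 - U (Z x)) * U (Z x) ^ n \<partial>L) * d ^ n)" ..
  qed
  interpret M: prob_space M by fact
  interpret N: prob_space N by fact
  have coeff: "(\<lambda>n. \<integral>x. (1 - U (X x)) * U (X x) ^ n \<partial>M) = (\<lambda>n. \<integral>x. (1 - U (Y x)) * U (Y x) ^ n \<partial>N)"
  proof (rule powser_coeff_unique)
    fix d :: real assume d: "\<bar>d\<bar> < 1"
    show "(\<Sum>n. (\<integral>x. (1 - U (X x)) * U (X x) ^ n \<partial>M) * d ^ n) = (\<Sum>n. (\<integral>x. (1 - U (Y x)) * U (Y x) ^ n \<partial>N) * d ^ n)"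
      using eq[of "1 - d"] d series[OF M X bX d] series[OF N Y bY d] by simp
  qed (use bnd[OF M X bX, of 0] bnd[OF N Y bY, of 0] in auto)
  have moments: "(\<integral>x. U (X x) ^ n \<partial>M) = (\<integral>x. U (Y x) ^ n \<partial>N)" for n
  proof (induction n)
    case (Suc n)
    then show ?case
      using tele[OF M X bX, of 0 n] tele[OF N Y bY, of 0 n] fun_cong[OF coeff, of n] by simp
  qed (simp add: M.prob_space N.prob_space)
  have "distr M borel (\<lambda>x. U (X x)) = distr N borel (\<lambda>x. U (Y x))"
    by (intro distr_eq_of_moments_eq M N eventually_mono[OF bX] eventually_mono[OF bY])
      (auto simp: moments Ub less_imp_le)
  then have "distr (distr M borel (\<lambda>x. U (X x))) borel (\<lambda>u. u / (1 - u))
           = distr (distr N borel (\<lambda>x. U (Y x))) borel (\<lambda>u. u / (1 - u))"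
    by simp
  moreover have "distr (distr L borel (\<lambda>x. U (Z x))) borel (\<lambda>u. u / (1 - u)) = distr L borel Z"
    if [measurable]: "Z \<in> borel_measurable L" and b: "AE x in L. 0 \<le> Z x" for L :: "'c measure" and Z
  proof -
    have "distr (distr L borel (\<lambda>x. U (Z x))) borel (\<lambda>u. u / (1 - u)) = distr L borel (\<lambda>x. U (Z x) / (1 - U (Z x)))"
      by (subst distr_distr) (auto simp: comp_def)
    also have "\<dots> = distr L borel Z"
    proof (rule distr_cong_AE)
      show "AE x in L. U (Z x) / (1 - U (Z x)) = Z x"
        using b by eventually_elim (auto simp: U_def field_simps)
    qed auto
    finally show ?thesis .
  qed
  ultimately show ?thesis
    using X Y bX bY by metis
qed

section \<open>The Stieltjes transform of the density\<close>

lemma contour_integral_horizontal_linepath: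
  fixes f :: "complex \<Rightarrow> complex"
  assumes "a < b"
  shows "contour_integral (linepath (Complex a y) (Complex b y)) f = integral {a..b} (\<lambda>t. f (Complex t y))"
proof -
  have sh: "linepath (Complex a y) (Complex b y) t = linepath (of_real a) (of_real b) t + \<i> * of_real y" for t
    by (simp add: linepath_def complex_eq_iff algebra_simps)
  have df: "Complex b y - Complex a y = of_real b - of_real a"
    by (simp add: complex_eq_iff)
  have "contour_integral (linepath (Complex a y) (Complex b y)) f
      = contour_integral (linepath (of_real a) (of_real b)) (\<lambda>z. f (z + \<i> * of_real y))"
    unfolding contour_integral_integral by (simp add: sh df)
  also have "\<dots> = integral {a..b} (\<lambda>t. f (of_real t + \<i> * of_real y))"
    using assms by (subst contour_integral_linepath_Reals_eq) auto
  finally show ?thesis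
    by (simp add: Complex_eq)
qed

lemma continuous_on_xi: "A \<subseteq> {0<..} \<Longrightarrow> continuous_on A xi"
proof -
  assume A: "A \<subseteq> {0<..}"
  have "continuous_on A (\<lambda>x. 1 / pi * sin (pi * x / (1 + x)) * x powr (- (x / (1 + x))))"
    using A by (intro continuous_intros) (auto simp: subset_iff)
  then show ?thesis
    by (rule continuous_on_eq) (use A in \<open>auto simp: xi_def\<close>)
qed

text \<open>
  \<open>(exp z - 1) / z\<close> with its removable singularity filled in. Both the singularity of \<open>w / (1 - w) * ln w\<close>
  at \<open>w = 1\<close> and the simple pole of the Cauchy kernel are expressed through it.
\<close>

definition expm1_quot :: "complex \<Rightarrow> complex" where
  "expm1_quot z = (if z = 0 then 1 else (exp z - 1) / z)"

lemma holomorphic_expm1_quot: "expm1_quot holomorphic_on A"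
proof -
  have "(\<lambda>z. if z = 0 then deriv exp 0 else (exp z - exp 0) / (z - 0)) holomorphic_on (UNIV :: complex set)"
    by (rule pole_lemma_open) (auto intro: holomorphic_intros)
  moreover have "deriv exp (0::complex) = 1"
    by (rule DERIV_imp_deriv) (auto intro!: derivative_eq_intros)
  ultimately have "expm1_quot holomorphic_on UNIV"
    by (simp add: expm1_quot_def[abs_def] cong: if_cong)
  then show ?thesis
    by (rule holomorphic_on_subset) simp
qed

text \<open>
  The strip of half width \<open>2 pi\<close> is open and convex and contains the closed strip of half width \<open>pi\<close>;
  there the only zero of \<open>exp z - 1\<close> is 0.
\<close>

lemma expm1_quot_nonzero:
  assumes "\<bar>Im z\<bar> < 2 * pi"
  shows "expm1_quot z \<noteq> 0"
proof (cases "z = 0")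
  case False
  have "exp z \<noteq> 1"
  proof
    assume "exp z = 1"
    then obtain n :: int where n: "Re z = 0" "Im z = of_int (2 * n) * pi"
      by (auto simp: exp_eq_1)
    have "\<bar>real_of_int n\<bar> < 1"
      using assms n(2) by (simp add: abs_mult)
    then have "n = 0" by linarith
    with n False show False by (simp add: complex_eq_iff)
  qed
  with False show ?thesis by (simp add: expm1_quot_def)
qed (simp add: expm1_quot_def)

lemma norm_exp_minus_one_ge: "\<bar>exp (Re z) - 1\<bar> \<le> norm (exp z - 1)"
  using norm_triangle_ineq3[of "exp z" 1] by (simp add: norm_exp_eq_Re)

text \<open>
  The integrand of Cauchy's formula in the variable \<open>z = ln w\<close>: the first factor is
  \<open>H w = exp (w / (1 - w) * ln w)\<close>, the second is \<open>w / (w - w\<^sub>0)\<close> for \<open>w\<^sub>0 = exp a\<close>, that is, the Cauchy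
  kernel times \<open>dw / dz\<close>.
\<close>

definition strip_kernel :: "real \<Rightarrow> complex \<Rightarrow> complex" where
  "strip_kernel a z = exp (- (z * exp z / (exp z - 1))) * (exp (z - of_real a) / (exp (z - of_real a) - 1))"

text \<open>
  On the right edge \<open>z exp z / (exp z - 1) = z + z / (exp z - 1)\<close>, where the second term is
  small, so \<open>H\<close> decays like \<open>exp (- R)\<close>.
\<close>

lemma strip_kernel_right_bound:
  assumes z: "Re z = R" "\<bar>Im z\<bar> \<le> pi" and R: "0 < R" "a < R"
  shows "norm (strip_kernel a z) \<le> exp (- R + (R + pi) / (exp R - 1)) * (exp (R - a) / (exp (R - a) - 1))"
proof -
  have e: "0 < exp R - 1" "exp R - 1 \<le> norm (exp z - 1)"
    using norm_exp_minus_one_ge[of z] R z by auto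
  have e': "0 < exp (R - a) - 1" "exp (R - a) - 1 \<le> norm (exp (z - of_real a) - 1)"
    using norm_exp_minus_one_ge[of "z - of_real a"] R z by auto
  have nz: "exp z - 1 \<noteq> 0" using e by auto
  have "norm z \<le> \<bar>Re z\<bar> + \<bar>Im z\<bar>" by (rule cmod_le)
  then have "norm z \<le> R + pi" using z R by simp
  then have q: "norm (z / (exp z - 1)) \<le> (R + pi) / (exp R - 1)"
    unfolding norm_divide using e R by (intro frac_le) auto
  have "- (z * exp z / (exp z - 1)) = - z - z / (exp z - 1)"
    using nz by (simp add: field_simps)
  then have "Re (- (z * exp z / (exp z - 1))) = - R - Re (z / (exp z - 1))"
    using z by (simp only: minus_complex.sel uminus_complex.sel)
  also have "\<dots> \<le> - R + (R + pi) / (exp R - 1)"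
    using q abs_Re_le_cmod[of "z / (exp z - 1)"] by linarith
  finally have 1: "norm (exp (- (z * exp z / (exp z - 1)))) \<le> exp (- R + (R + pi) / (exp R - 1))"
    unfolding norm_exp_eq_Re by simp
  have 2: "norm (exp (z - of_real a) / (exp (z - of_real a) - 1)) \<le> exp (R - a) / (exp (R - a) - 1)"
    unfolding norm_divide using e' z by (intro frac_le) (auto simp: norm_exp_eq_Re)
  show ?thesis
    unfolding strip_kernel_def norm_mult using 1 2 by (intro mult_mono) auto
qed

text \<open>
  On the left edge \<open>H\<close> stays bounded and the decay comes from the Cauchy kernel.
\<close>

lemma strip_kernel_left_bound:
  assumes z: "Re z = - R" "\<bar>Im z\<bar> \<le> pi" and R: "0 < R" "- R < a"
  shows "norm (strip_kernel a z) \<le> exp ((R + pi) * (exp (- R) / (1 - exp (- R)))) * (exp (- R - a) / (1 - exp (- R - a)))"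
proof -
  have e: "0 < 1 - exp (- R)" "1 - exp (- R) \<le> norm (exp z - 1)"
    using norm_exp_minus_one_ge[of z] R z by auto
  have e': "0 < 1 - exp (- R - a)" "1 - exp (- R - a) \<le> norm (exp (z - of_real a) - 1)"
    using norm_exp_minus_one_ge[of "z - of_real a"] R z by auto
  have "norm z \<le> \<bar>Re z\<bar> + \<bar>Im z\<bar>" by (rule cmod_le)
  then have nz: "norm z \<le> R + pi" using z R by simp
  have "norm (exp z / (exp z - 1)) \<le> exp (- R) / (1 - exp (- R))"
    unfolding norm_divide using e R z by (intro frac_le) (auto simp: norm_exp_eq_Re)
  with nz have "norm (z * (exp z / (exp z - 1))) \<le> (R + pi) * (exp (- R) / (1 - exp (- R)))"
    unfolding norm_mult using R by (intro mult_mono) auto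
  then have "Re (- (z * exp z / (exp z - 1))) \<le> (R + pi) * (exp (- R) / (1 - exp (- R)))"
    using complex_Re_le_cmod[of "- (z * exp z / (exp z - 1))"] by simp
  then have 1: "norm (exp (- (z * exp z / (exp z - 1)))) \<le> exp ((R + pi) * (exp (- R) / (1 - exp (- R))))"
    unfolding norm_exp_eq_Re by simp
  have 2: "norm (exp (z - of_real a) / (exp (z - of_real a) - 1)) \<le> exp (- R - a) / (1 - exp (- R - a))"
    unfolding norm_divide using e' z by (intro frac_le) (auto simp: norm_exp_eq_Re)
  show ?thesis
    unfolding strip_kernel_def norm_mult using 1 2 by (intro mult_mono) auto
qed

text \<open>
  On both horizontal edges \<open>exp z\<close> equals \<open>- exp t\<close>, so only the factor \<open>z\<close> in the exponent of
  \<open>H\<close> distinguishes them. With \<open>p = exp t / (1 + exp t)\<close> the two values of \<open>H\<close> are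
  \<open>exp (- t p) cis (\<plusminus> pi p)\<close>, and their difference is the density.
\<close>

lemma strip_kernel_jump:
  fixes a t :: real
  shows "strip_kernel a (Complex t (- pi)) - strip_kernel a (Complex t pi)
       = 2 * pi * \<i> * of_real (xi (exp t) * exp t / (exp t + exp a))"
proof -
  define p where "p = exp t / (1 + exp t)"
  have c: "cis (- pi) = -1" by (simp add: complex_eq_iff)
  have e: "exp (Complex t s) = - of_real (exp t)" and ea: "exp (Complex t s - of_real a) = - of_real (exp (t - a))"
    if "s = pi \<or> s = - pi" for s
  proof -
    show "exp (Complex t s) = - of_real (exp t)"
      using that c by (auto simp: exp_eq_polar)
    have "Complex t s - of_real a = Complex (t - a) s" by (simp add: complex_eq_iff)
    then show "exp (Complex t s - of_real a) = - of_real (exp (t - a))"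
      using that c by (auto simp: exp_eq_polar)
  qed
  have neg_quot: "- X / (- X - 1) = X / (X + 1)" for X :: complex
  proof -
    have "- X - 1 = - (X + 1)" by simp
    then show ?thesis by (simp only: minus_divide_divide)
  qed
  have fac: "(- of_real (exp (t - a)) / (- of_real (exp (t - a)) - 1) :: complex) = of_real (exp t / (exp t + exp a))"
  proof -
    have "exp (t - a) / (exp (t - a) + 1) = exp t / (exp t + exp a)"
      by (simp add: exp_diff field_simps)
    moreover have "(- of_real (exp (t - a)) / (- of_real (exp (t - a)) - 1) :: complex) = of_real (exp (t - a) / (exp (t - a) + 1))"
      unfolding neg_quot by simp
    ultimately show ?thesis by simp
  qed
  have pc: "(- of_real (exp t) / (- of_real (exp t) - 1) :: complex) = of_real p"
    unfolding neg_quot by (simp add: p_def add.commute)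
  have h: "exp (- (Complex t s * exp (Complex t s) / (exp (Complex t s) - 1))) = of_real (exp (- (t * p))) * cis (- (s * p))"
    if "s = pi \<or> s = - pi" for s
  proof -
    have "Complex t s * exp (Complex t s) / (exp (Complex t s) - 1) = Complex t s * of_real p"
      unfolding e[OF that] times_divide_eq_right[symmetric] pc ..
    also have "- \<dots> = Complex (- (t * p)) (- (s * p))"
      by (simp add: complex_eq_iff)
    finally show ?thesis
      by (simp add: exp_eq_polar)
  qed
  have K: "strip_kernel a (Complex t s) = of_real (exp (- (t * p))) * cis (- (s * p)) * of_real (exp t / (exp t + exp a))"
    if "s = pi \<or> s = - pi" for s
    unfolding strip_kernel_def h[OF that] ea[OF that] fac ..
  have xi: "xi (exp t) = 1 / pi * sin (pi * p) * exp (- (t * p))"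
    by (simp add: xi_def p_def powr_def)
  have "cis (pi * p) - cis (- (pi * p)) = 2 * \<i> * of_real (sin (pi * p))"
    by (simp add: complex_eq_iff)
  then have "strip_kernel a (Complex t (- pi)) - strip_kernel a (Complex t pi)
      = of_real (exp (- (t * p))) * (2 * \<i> * of_real (sin (pi * p))) * of_real (exp t / (exp t + exp a))"
    by (simp only: K simp_thms left_diff_distrib[symmetric] right_diff_distrib[symmetric] minus_mult_left[symmetric] minus_minus)
  also have "\<dots> = 2 * pi * \<i> * of_real (xi (exp t) * exp t / (exp t + exp a))"
    by (simp add: xi)
  finally show ?thesis .
qed

text \<open>
  The value \<open>H (exp a)\<close> at a point of the positive axis, continued to \<open>a = 0\<close>.
\<close>

definition strip_value :: "real \<Rightarrow> real" where
  "strip_value a = (if a = 0 then exp (- 1) else exp (- (a * exp a / (exp a - 1))))"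

text \<open>
  Cauchy's formula at the point \<open>a\<close> for the rectangle \<open>[- R, R] \<times> [- pi, pi]\<close>: the horizontal edges
  together contribute the integral of the jump, and the right side of the estimate bounds the vertical ones.
\<close>

lemma rectangle_integral_estimate:
  fixes a R :: real
  assumes R: "0 < R" "\<bar>a\<bar> < R"
  shows "\<bar>strip_value a - integral {- R..R} (\<lambda>t. xi (exp t) * exp t / (exp t + exp a))\<bar>
    \<le> exp (- R + (R + pi) / (exp R - 1)) * (exp (R - a) / (exp (R - a) - 1))
      + exp ((R + pi) * (exp (- R) / (1 - exp (- R)))) * (exp (- R - a) / (1 - exp (- R - a)))"
    (is "_ \<le> ?E1 + ?E2")
proof -
  let ?S = "{z. \<bar>Im z\<bar> < 2 * pi}"
  have Seq: "?S = {z. Im z < 2 * pi} \<inter> {z. Im z > - (2 * pi)}" by auto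
  have conv: "convex ?S"
    unfolding Seq by (intro convex_Int convex_halfspace_Im_lt convex_halfspace_Im_gt)
  have opn: "open ?S"
    unfolding Seq by (intro open_Int open_halfspace_Im_lt open_halfspace_Im_gt)
  define f where "f z = exp (- (exp z / expm1_quot z)) * (exp (z - of_real a) / expm1_quot (z - of_real a))" for z
  define F where "F z = f z / (z - of_real a)" for z
  have comp: "(\<lambda>z. expm1_quot (z - of_real a)) holomorphic_on ?S"
    by (rule holomorphic_on_compose_gen[unfolded o_def, OF _ holomorphic_expm1_quot[of UNIV]])
       (auto intro!: holomorphic_intros)
  have holo: "f holomorphic_on ?S"
    unfolding f_def by (intro holomorphic_intros holomorphic_expm1_quot comp)
      (auto intro!: expm1_quot_nonzero)
  \<comment> \<open>\<open>F\<close> is \<open>strip_kernel a\<close> in the form required by Cauchy's formula: a holomorphic function over \<open>z - a\<close>.\<close>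
  have FK: "F z = strip_kernel a z" if "z \<noteq> 0" "z \<noteq> of_real a" for z
    using that by (simp add: F_def f_def strip_kernel_def expm1_quot_def mult_ac)
  have contF: "continuous_on A F" if "A \<subseteq> ?S - {of_real a}" for A
    unfolding F_def using that
    by (intro continuous_intros continuous_on_subset[OF holomorphic_on_imp_continuous_on[OF holo]]) auto
  define a1 a2 a3 a4 where "a1 = Complex (- R) (- pi)" and "a2 = Complex R (- pi)"
    and "a3 = Complex R pi" and "a4 = Complex (- R) pi"
  have rect: "rectpath a1 a3 = linepath a1 a2 +++ linepath a2 a3 +++ linepath a3 a4 +++ linepath a4 a1"
    by (simp add: rectpath_def Let_def a1_def a2_def a3_def a4_def)
  have inbox: "of_real a \<in> box a1 a3"
    using R pi_gt_zero by (auto simp: in_box_complex_iff a1_def a3_def)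
  have img: "path_image (rectpath a1 a3) \<subseteq> ?S - {of_real a}"
  proof -
    have "path_image (rectpath a1 a3) \<subseteq> cbox a1 a3 - box a1 a3"
      using R pi_gt_zero by (subst path_image_rectpath_cbox_minus_box) (auto simp: a1_def a3_def)
    also have "\<dots> \<subseteq> ?S - {of_real a}"
    proof
      fix z assume z: "z \<in> cbox a1 a3 - box a1 a3"
      then have "\<bar>Im z\<bar> \<le> pi"
        by (auto simp: in_cbox_complex_iff a1_def a3_def)
      then have "\<bar>Im z\<bar> < 2 * pi"
        using pi_gt_zero by linarith
      then show "z \<in> ?S - {of_real a}"
        using z inbox by auto
    qed
    finally show ?thesis .
  qed
  have "((\<lambda>w. f w / (w - of_real a)) has_contour_integral (2 * pi * \<i> * winding_number (rectpath a1 a3) (of_real a) * f (of_real a))) (rectpath a1 a3)"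
    using conv holo img opn pi_gt_zero
    by (intro Cauchy_integral_formula_convex_simple[where S="?S"]) (auto simp: interior_open)
  then have total: "contour_integral (rectpath a1 a3) F = 2 * pi * \<i> * f (of_real a)"
    unfolding F_def using winding_number_rectpath[OF inbox] by (auto dest: contour_integral_unique)
  have segs: "closed_segment a1 a2 \<subseteq> ?S - {of_real a}" "closed_segment a2 a3 \<subseteq> ?S - {of_real a}"
     "closed_segment a3 a4 \<subseteq> ?S - {of_real a}" "closed_segment a4 a1 \<subseteq> ?S - {of_real a}"
    using img unfolding rect by (auto simp: path_image_join)
  note cF = segs[THEN contF]
  note intF = cF[THEN contour_integrable_continuous_linepath]
  have split: "contour_integral (rectpath a1 a3) F
     = contour_integral (linepath a1 a2) F + contour_integral (linepath a2 a3) F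
       + contour_integral (linepath a3 a4) F + contour_integral (linepath a4 a1) F"
    unfolding rect using intF by (simp add: add.assoc)
  have KF: "strip_kernel a (Complex t s) = F (Complex t s)" if "s = pi \<or> s = - pi" for t s
    by (rule FK[symmetric]) (use that pi_gt_zero in \<open>auto simp: complex_eq_iff\<close>)
  have horiz1: "contour_integral (linepath a1 a2) F = integral {- R..R} (\<lambda>t. F (Complex t (- pi)))"
    unfolding a1_def a2_def using R by (intro contour_integral_horizontal_linepath) simp
  have horiz3: "contour_integral (linepath a3 a4) F = - integral {- R..R} (\<lambda>t. F (Complex t pi))"
  proof -
    have "contour_integral (linepath a3 a4) F = - contour_integral (linepath a4 a3) F"
      by (rule contour_integral_reverse_linepath[OF cF(3)])
    also have "contour_integral (linepath a4 a3) F = integral {- R..R} (\<lambda>t. F (Complex t pi))"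
      unfolding a3_def a4_def using R by (intro contour_integral_horizontal_linepath) simp
    finally show ?thesis .
  qed
  have hint: "(\<lambda>t. F (Complex t s)) integrable_on {- R..R}" if "s = pi \<or> s = - pi" for s
  proof (rule integrable_continuous_interval)
    have c: "continuous_on ((\<lambda>t. Complex t s) ` {- R..R}) F"
      by (rule contF) (use that pi_gt_zero in \<open>auto simp: complex_eq_iff\<close>)
    show "continuous_on {- R..R} (\<lambda>t. F (Complex t s))"
      by (rule continuous_on_compose2[OF c]) (auto simp: Complex_eq intro!: continuous_intros)
  qed
  have jump: "integral {- R..R} (\<lambda>t. F (Complex t (- pi))) - integral {- R..R} (\<lambda>t. F (Complex t pi))
      = 2 * pi * \<i> * of_real (integral {- R..R} (\<lambda>t. xi (exp t) * exp t / (exp t + exp a)))"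
  proof -
    have "integral {- R..R} (\<lambda>t. F (Complex t (- pi))) - integral {- R..R} (\<lambda>t. F (Complex t pi))
        = integral {- R..R} (\<lambda>t. F (Complex t (- pi)) - F (Complex t pi))"
      by (rule Henstock_Kurzweil_Integration.integral_diff[symmetric]) (auto intro: hint)
    also have "\<dots> = integral {- R..R} (\<lambda>t. 2 * pi * \<i> * of_real (xi (exp t) * exp t / (exp t + exp a)))"
      by (rule Henstock_Kurzweil_Integration.integral_cong) (simp add: KF[symmetric] strip_kernel_jump del: of_real_mult of_real_divide)
    also have "\<dots> = 2 * pi * \<i> * of_real (integral {- R..R} (\<lambda>t. xi (exp t) * exp t / (exp t + exp a)))"
    proof -
      have "(\<lambda>t. xi (exp t) * exp t / (exp t + exp a)) integrable_on {- R..R}"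
        by (intro integrable_continuous_interval continuous_intros continuous_on_compose2[OF continuous_on_xi[OF subset_refl]])
          (auto simp: add_pos_pos[THEN less_imp_neq, symmetric])
      from has_integral_of_real[OF integrable_integral[OF this], where 'b=complex]
      show ?thesis
        by (simp only: integral_mult_right integral_unique)
    qed
    finally show ?thesis .
  qed
  have seg2: "Re z = R \<and> \<bar>Im z\<bar> \<le> pi" if "z \<in> closed_segment a2 a3" for z
    using that by (auto simp: a2_def a3_def closed_segment_same_Re closed_segment_eq_real_ivl)
  have seg4: "Re z = - R \<and> \<bar>Im z\<bar> \<le> pi" if "z \<in> closed_segment a4 a1" for z
    using that by (auto simp: a1_def a4_def closed_segment_same_Re closed_segment_eq_real_ivl split: if_splits)
  have E: "0 \<le> ?E1" "0 \<le> ?E2"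
    using R by (auto intro!: mult_nonneg_nonneg divide_nonneg_nonneg)
  have "norm (contour_integral (linepath a2 a3) F) \<le> ?E1 * norm (a3 - a2)"
  proof (rule contour_integral_bound_linepath[OF intF(2) E(1)])
    fix z assume z: "z \<in> closed_segment a2 a3"
    have "z \<noteq> 0" "z \<noteq> of_real a" using seg2[OF z] R by auto
    then show "norm (F z) \<le> ?E1"
      using seg2[OF z] R strip_kernel_right_bound[of z R a] by (subst FK) auto
  qed
  moreover have "norm (a3 - a2) = 2 * pi"
    by (simp add: a2_def a3_def cmod_def real_sqrt_mult)
  ultimately have v2: "norm (contour_integral (linepath a2 a3) F) \<le> ?E1 * (2 * pi)"
    by (simp only:)
  have "norm (contour_integral (linepath a4 a1) F) \<le> ?E2 * norm (a1 - a4)"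
  proof (rule contour_integral_bound_linepath[OF intF(4) E(2)])
    fix z assume z: "z \<in> closed_segment a4 a1"
    have "z \<noteq> 0" "z \<noteq> of_real a" using seg4[OF z] R by auto
    then show "norm (F z) \<le> ?E2"
      using seg4[OF z] R strip_kernel_left_bound[of z R a] by (subst FK) auto
  qed
  moreover have "norm (a1 - a4) = 2 * pi"
    by (simp add: a1_def a4_def cmod_def real_sqrt_mult)
  ultimately have v4: "norm (contour_integral (linepath a4 a1) F) \<le> ?E2 * (2 * pi)"
    by (simp only:)
  let ?I = "integral {- R..R} (\<lambda>t. xi (exp t) * exp t / (exp t + exp a))"
  have fa: "f (of_real a) = of_real (strip_value a)"
    by (simp add: f_def expm1_quot_def strip_value_def exp_of_real[symmetric] mult.commute)
  have "2 * pi * \<i> * of_real (strip_value a - ?I) = contour_integral (linepath a2 a3) F + contour_integral (linepath a4 a1) F"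
    using total split horiz1 horiz3 jump fa by (simp add: algebra_simps)
  then have "norm (2 * pi * \<i> * of_real (strip_value a - ?I)) \<le> ?E1 * (2 * pi) + ?E2 * (2 * pi)"
    using norm_triangle_ineq[of "contour_integral (linepath a2 a3) F" "contour_integral (linepath a4 a1) F"] v2 v4 by simp
  also have "norm (2 * pi * \<i> * of_real (strip_value a - ?I)) = 2 * pi * \<bar>strip_value a - ?I\<bar>"
    by (simp only: norm_mult norm_of_real norm_ii) simp
  finally have "2 * pi * \<bar>strip_value a - ?I\<bar> \<le> 2 * pi * (?E1 + ?E2)"
    by (simp add: algebra_simps)
  then show ?thesis
    by simp
qed

lemma xi_nonneg: "0 \<le> xi x"
proof (cases "0 < x")
  case True
  then have "0 \<le> pi * x / (1 + x)" "pi * x / (1 + x) \<le> pi"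
    by (auto simp: field_simps)
  then have "0 \<le> sin (pi * x / (1 + x))"
    by (rule sin_ge_zero)
  with True show ?thesis
    by (simp add: xi_def)
qed (simp add: xi_def)

lemma xi_measurable [measurable]: "xi \<in> borel_measurable borel"
  unfolding xi_def by measurable

text \<open>
  Let \<open>R\<close> tend to infinity in the preceding estimate, after the substitution \<open>x = exp t\<close>.
\<close>

lemma nn_integral_xi_Cauchy:
  fixes a :: real
  shows "(\<integral>\<^sup>+x. ennreal (xi x / (x + exp a)) \<partial>lborel) = ennreal (strip_value a)"
proof -
  let ?g = "\<lambda>x. xi x / (x + exp a)"
  define I where "I R = integral {- R..R} (\<lambda>t. xi (exp t) * exp t / (exp t + exp a))" for R :: real
  define E where "E R = exp (- R + (R + pi) / (exp R - 1)) * (exp (R - a) / (exp (R - a) - 1))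
      + exp ((R + pi) * (exp (- R) / (1 - exp (- R)))) * (exp (- R - a) / (1 - exp (- R - a)))" for R
  have E0: "(E \<longlongrightarrow> 0) at_top"
    unfolding E_def by real_asymp
  have "eventually (\<lambda>R. \<bar>I R - strip_value a\<bar> \<le> E R) at_top"
    using eventually_gt_at_top[of "\<bar>a\<bar>"] eventually_gt_at_top[of 0]
  proof eventually_elim
    case (elim R)
    then show ?case
      using rectangle_integral_estimate[of R a] unfolding I_def E_def by (simp add: abs_minus_commute)
  qed
  then have "((\<lambda>R. I R - strip_value a) \<longlongrightarrow> 0) at_top"
    by (intro Lim_null_comparison[OF _ E0]) simp
  then have "(I \<longlongrightarrow> strip_value a) at_top"
    by (simp add: LIM_zero_iff)
  then have I_lim: "(\<lambda>n. I (real n)) \<longlonglongrightarrow> strip_value a"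
    by (rule filterlim_compose[OF _ filterlim_real_sequentially])
  have I_eq: "(\<integral>\<^sup>+x. ennreal (?g x) * indicator {exp (- real n)..exp (real n)} x \<partial>lborel) = ennreal (I (real n))" for n
  proof -
    let ?A = "{exp (- real n)..exp (real n)}"
    have pos: "0 < x" if "x \<in> ?A" for x
      using that less_le_trans[OF exp_gt_zero[of "- real n"], of x] by simp
    have cont: "continuous_on ?A ?g"
    proof (intro continuous_intros continuous_on_xi)
      show "?A \<subseteq> {0<..}" using pos by auto
      show "\<forall>x\<in>?A. x + exp a \<noteq> 0"
        using pos by (metis add_pos_pos exp_gt_zero less_irrefl)
    qed
    have "((\<lambda>t. exp t *\<^sub>R ?g (exp t)) has_integral (integral {exp (- real n)..exp (real n)} ?g)) {- real n..real n}"
      by (rule has_integral_substitution[where c="exp (- real n)" and d="exp (real n)"])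
        (use cont in \<open>auto intro!: derivative_eq_intros\<close>)
    then have I_sub: "I (real n) = integral ?A ?g"
      unfolding I_def by (simp add: integral_unique mult.commute)
    have "(?g has_integral I (real n)) ?A"
      unfolding I_sub by (intro integrable_integral integrable_continuous_interval cont)
    moreover have "(\<lambda>x. ?g x * indicator ?A x) = (\<lambda>x. if x \<in> ?A then ?g x else 0)"
      by (auto simp: indicator_def)
    ultimately have "((\<lambda>x. ?g x * indicator ?A x) has_integral I (real n)) UNIV"
      by (simp only: has_integral_restrict_UNIV)
    then have "(\<integral>\<^sup>+x. ennreal (?g x * indicator ?A x) \<partial>lborel) = ennreal (I (real n))"
      by (rule nn_integral_has_integral_lborel[rotated -1])
        (use pos in \<open>auto simp: indicator_def intro!: divide_nonneg_pos xi_nonneg add_pos_pos\<close>)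
    moreover have "ennreal (?g x) * indicator ?A x = ennreal (?g x * indicator ?A x)" for x
      by (simp add: indicator_def)
    ultimately show ?thesis by simp
  qed
  have "(\<lambda>n. \<integral>\<^sup>+x. ennreal (?g x) * indicator {exp (- real n)..exp (real n)} x \<partial>lborel)
      \<longlonglongrightarrow> (\<integral>\<^sup>+x. ennreal (?g x) \<partial>lborel)"
  proof (rule nn_integral_LIMSEQ)
    show "incseq (\<lambda>n x. ennreal (?g x) * indicator {exp (- real n)..exp (real n)} x)"
      unfolding incseq_def le_fun_def
    proof (intro allI impI mult_left_mono)
      fix m n :: nat and x :: real assume "m \<le> n"
      then have "{exp (- real m)..exp (real m)} \<subseteq> {exp (- real n)..exp (real n)}"
        unfolding atLeastatMost_subset_iff by (simp del: exp_le_cancel_iff add: exp_le_cancel_iff[THEN iffD2])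
      then show "(indicator {exp (- real m)..exp (real m)} x :: ennreal) \<le> indicator {exp (- real n)..exp (real n)} x"
        by (intro indicator_leI) (rule subsetD)
    qed simp
    show "(\<lambda>n. ennreal (?g x) * indicator {exp (- real n)..exp (real n)} x) \<longlonglongrightarrow> ennreal (?g x)" for x
    proof (cases "0 < x")
      case True
      obtain N :: nat where N: "\<bar>ln x\<bar> \<le> real N" using real_arch_simple by blast
      have "eventually (\<lambda>n. ennreal (?g x) * indicator {exp (- real n)..exp (real n)} x = ennreal (?g x)) sequentially"
        using eventually_ge_at_top[of N]
      proof eventually_elim
        case (elim n)
        then have "- real n \<le> ln x" "ln x \<le> real n" using N by auto
        then have "exp (- real n) \<le> x" "x \<le> exp (real n)"
          using True by (metis exp_le_cancel_iff exp_ln)+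
        then show ?case by simp
      qed
      then show ?thesis by (rule tendsto_eventually)
    next
      case False
      then show ?thesis by (simp add: xi_def)
    qed
  qed measurable
  then have "(\<lambda>n. ennreal (I (real n))) \<longlonglongrightarrow> (\<integral>\<^sup>+x. ennreal (?g x) \<partial>lborel)"
    by (simp add: I_eq)
  moreover have "(\<lambda>n. ennreal (I (real n))) \<longlonglongrightarrow> ennreal (strip_value a)"
    by (intro tendsto_ennrealI I_lim)
  ultimately show ?thesis
    by (rule LIMSEQ_unique)
qed

text \<open>
  The previous identity at \<open>w = 1 / l\<close>, because \<open>1 / (1 + l x) = w / (w + x)\<close> and
  \<open>w * exp (w / (1 - w) * ln w) = exp (ln w / (1 - w))\<close>.
\<close>

lemma nn_integral_xi_Stieltjes:
  assumes l: "0 < l"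
  shows "(\<integral>\<^sup>+x. ennreal (xi x / (1 + l * x)) \<partial>lborel) = ennreal (exp (- (if l = 1 then 1 else l / (l - 1) * ln l)))"
proof -
  define a where "a = - ln l"
  have w: "exp a = 1 / l" using l by (simp add: a_def exp_minus inverse_eq_divide)
  have "(\<integral>\<^sup>+x. ennreal (xi x / (1 + l * x)) \<partial>lborel) = (\<integral>\<^sup>+x. ennreal (1 / l) * ennreal (xi x / (x + exp a)) \<partial>lborel)"
  proof (rule nn_integral_cong)
    fix x :: real
    have "xi x / (1 + l * x) = 1 / l * (xi x / (x + exp a))"
      using l by (simp add: w field_simps)
    moreover have "0 \<le> xi x / (x + exp a)"
    proof (cases "0 < x")
      case True
      then have "0 < x + exp a" by (intro add_pos_pos) simp_all
      then show ?thesis using xi_nonneg[of x] by simp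
    qed (simp add: xi_def)
    ultimately show "ennreal (xi x / (1 + l * x)) = ennreal (1 / l) * ennreal (xi x / (x + exp a))"
      using l by (simp only: ennreal_mult[symmetric] divide_nonneg_pos zero_le_one)
  qed
  also have "\<dots> = ennreal (1 / l) * ennreal (strip_value a)"
    by (subst nn_integral_cmult) (auto simp: nn_integral_xi_Cauchy)
  also have "\<dots> = ennreal (1 / l * strip_value a)"
    using l by (intro ennreal_mult[symmetric]) (auto simp: strip_value_def)
  also have "1 / l * strip_value a = exp (- (if l = 1 then 1 else l / (l - 1) * ln l))"
  proof (cases "l = 1")
    case False
    then have a0: "a \<noteq> 0" using l by (simp add: a_def)
    have "1 / l * strip_value a = exp (a + - (a * exp a / (exp a - 1)))"
      unfolding exp_add using a0 by (simp add: strip_value_def w)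
    also have "a + - (a * exp a / (exp a - 1)) = - (l / (l - 1) * ln l)"
    proof -
      have "exp a / (exp a - 1) = 1 / (1 - l)"
        unfolding w using l False by (simp add: field_simps)
      then have "a + - (a * exp a / (exp a - 1)) = a + - (a * (1 / (1 - l)))"
        by (metis times_divide_eq_right)
      also have "\<dots> = - (l / (l - 1) * ln l)"
        using False by (simp add: a_def field_simps)
      finally show ?thesis .
    qed
    finally show ?thesis using False by simp
  qed (simp add: a_def strip_value_def)
  finally show ?thesis .
qed

text \<open>
  The total mass is the limit of the transform as \<open>l\<close> decreases to 0.
\<close>

lemma nn_integral_xi: "(\<integral>\<^sup>+x. ennreal (xi x) \<partial>lborel) = 1"
proof -
  let ?l = "\<lambda>n. 1 / (real n + 2)"
  have "(\<lambda>n. \<integral>\<^sup>+x. ennreal (xi x / (1 + ?l n * x)) \<partial>lborel) \<longlonglongrightarrow> (\<integral>\<^sup>+x. ennreal (xi x) \<partial>lborel)"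
  proof (rule nn_integral_LIMSEQ)
    show "incseq (\<lambda>n x. ennreal (xi x / (1 + ?l n * x)))"
      unfolding incseq_def le_fun_def
    proof (intro allI impI)
      fix m n :: nat and x :: real assume mn: "m \<le> n"
      show "ennreal (xi x / (1 + ?l m * x)) \<le> ennreal (xi x / (1 + ?l n * x))"
      proof (cases "0 < x")
        case True
        then have "?l n * x \<le> ?l m * x"
          using mn by (intro mult_right_mono divide_left_mono) auto
        then show ?thesis
          using True by (intro ennreal_leI divide_left_mono mult_pos_pos add_pos_nonneg xi_nonneg) auto
      qed (simp add: xi_def)
    qed
    show "(\<lambda>n. ennreal (xi x / (1 + ?l n * x))) \<longlonglongrightarrow> ennreal (xi x)" for x
    proof (rule tendsto_ennrealI)
      have "?l \<longlonglongrightarrow> 0" by real_asymp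
      then have "(\<lambda>n. xi x / (1 + ?l n * x)) \<longlonglongrightarrow> xi x / (1 + 0 * x)"
        by (intro tendsto_intros) auto
      then show "(\<lambda>n. xi x / (1 + ?l n * x)) \<longlonglongrightarrow> xi x" by simp
    qed
  qed measurable
  moreover have "(\<lambda>n. \<integral>\<^sup>+x. ennreal (xi x / (1 + ?l n * x)) \<partial>lborel) \<longlonglongrightarrow> ennreal 1"
  proof -
    have "(\<lambda>n. ennreal (exp (- (?l n / (?l n - 1) * ln (?l n))))) \<longlonglongrightarrow> ennreal 1"
      by (intro tendsto_ennrealI) real_asymp
    then show ?thesis
      by (subst nn_integral_xi_Stieltjes) auto
  qed
  ultimately show ?thesis
    using LIMSEQ_unique by fastforce
qed

lemma prob_space_xi: "prob_space (density lborel (\<lambda>x. ennreal (xi x)))"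
  by (rule prob_spaceI) (simp add: emeasure_density nn_integral_xi)

section \<open>Ratios and products with exponential variables\<close>

lemma (in prob_space) nn_integral_indep_pair:
  assumes ind: "indep_var borel X borel Y"
    and g[measurable]: "g \<in> borel_measurable (borel \<Otimes>\<^sub>M borel)"
  shows "(\<integral>\<^sup>+\<omega>. g (X \<omega>, Y \<omega>) \<partial>M) = (\<integral>\<^sup>+y. \<integral>\<^sup>+x. g (x, y) \<partial>distr M borel X \<partial>distr M borel Y)"
proof -
  have X[measurable]: "X \<in> borel_measurable M" and Y[measurable]: "Y \<in> borel_measurable M"
    and joint: "distr M borel X \<Otimes>\<^sub>M distr M borel Y = distr M (borel \<Otimes>\<^sub>M borel) (\<lambda>x. (X x, Y x))"
    using ind unfolding indep_var_distribution_eq by auto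
  interpret DX: prob_space "distr M borel X" by (rule prob_space_distr) simp
  interpret DY: prob_space "distr M borel Y" by (rule prob_space_distr) simp
  interpret P: pair_sigma_finite "distr M borel X" "distr M borel Y" ..
  have "(\<integral>\<^sup>+\<omega>. g (X \<omega>, Y \<omega>) \<partial>M) = (\<integral>\<^sup>+z. g z \<partial>distr M (borel \<Otimes>\<^sub>M borel) (\<lambda>x. (X x, Y x)))"
    by (subst nn_integral_distr) auto
  also have "\<dots> = (\<integral>\<^sup>+z. g z \<partial>(distr M borel X \<Otimes>\<^sub>M distr M borel Y))"
    by (simp only: joint)
  also have "\<dots> = (\<integral>\<^sup>+y. \<integral>\<^sup>+x. g (x, y) \<partial>distr M borel X \<partial>distr M borel Y)"
    by (rule P.nn_integral_snd[symmetric]) measurable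
  finally show ?thesis .
qed

lemma distr_borel_of_distributed:
  fixes X :: "'a \<Rightarrow> real"
  assumes "distributed M lborel X f"
  shows "distr M borel X = density lborel f"
proof -
  have "distr M borel X = distr M lborel X"
    by (rule distr_cong) auto
  then show ?thesis
    using assms by (simp add: distributed_def)
qed

lemma nn_integral_exponential_Laplace:
  fixes c :: real
  assumes c: "0 \<le> c"
  shows "(\<integral>\<^sup>+x. ennreal (exponential_density 1 x) * ennreal (exp (- c * x)) \<partial>lborel) = ennreal (1 / (1 + c))"
proof -
  interpret E: prob_space "density lborel (exponential_density (1 + c))"
    using c by (intro prob_space_exponential_density) simp
  have "(\<integral>\<^sup>+x. ennreal (exponential_density 1 x) * ennreal (exp (- c * x)) \<partial>lborel)
      = (\<integral>\<^sup>+x. ennreal (1 / (1 + c)) * ennreal (exponential_density (1 + c) x) \<partial>lborel)"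
  proof (rule nn_integral_cong)
    fix x :: real
    have "exp (- x) * exp (- c * x) = exp (- x * (1 + c))"
      by (simp add: exp_add[symmetric] algebra_simps)
    then have "exponential_density 1 x * exp (- c * x) = 1 / (1 + c) * exponential_density (1 + c) x"
      using c by (simp add: exponential_density_def)
    then show "ennreal (exponential_density 1 x) * ennreal (exp (- c * x))
        = ennreal (1 / (1 + c)) * ennreal (exponential_density (1 + c) x)"
      using c by (simp add: ennreal_mult[symmetric] exponential_density_nonneg)
  qed
  also have "\<dots> = ennreal (1 / (1 + c)) * (\<integral>\<^sup>+x. ennreal (exponential_density (1 + c) x) \<partial>lborel)"
    by (rule nn_integral_cmult) simp
  also have "(\<integral>\<^sup>+x. ennreal (exponential_density (1 + c) x) \<partial>lborel) = 1"
    using E.emeasure_space_1 by (simp add: emeasure_density)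
  finally show ?thesis by simp
qed

text \<open>
  Substituting \<open>x = y w\<close> and exchanging the integrals leaves the density
  \<open>\<integral>y exp (- (1 + w) y) dy = 1 / (1 + w)\<^sup>2\<close>, a first moment of an exponential law.
\<close>

lemma (in prob_space) distributed_exponential_ratio:
  assumes E1: "distributed M lborel E1 (\<lambda>x. ennreal (exponential_density 1 x))"
    and E2: "distributed M lborel E2 (\<lambda>x. ennreal (exponential_density 1 x))"
    and ind: "indep_var borel E1 borel E2"
  shows "distributed M lborel (\<lambda>\<omega>. E1 \<omega> / E2 \<omega>) (\<lambda>x. ennreal (if x > 0 then 1 / (1 + x)\<^sup>2 else 0))"
proof -
  let ?e = "exponential_density 1"
  let ?f = "\<lambda>x. ennreal (if x > 0 then 1 / (1 + x)\<^sup>2 else 0)"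
  have m[measurable]: "E1 \<in> borel_measurable M" "E2 \<in> borel_measurable M"
    using ind unfolding indep_var_distribution_eq by auto
  \<comment> \<open>At \<open>w = 0\<close> the integral is 1 while the density is 0 there; a null set.\<close>
  have inner: "(\<integral>\<^sup>+y. ennreal (?e y) * (ennreal y * ennreal (?e (y * w))) \<partial>lborel) = ?f w" if "w \<noteq> 0" for w
  proof (cases "0 < w")
    case True
    have "(\<integral>\<^sup>+y. ennreal (?e y) * (ennreal y * ennreal (?e (y * w))) \<partial>lborel)
        = (\<integral>\<^sup>+y. ennreal (1 / (1 + w)) * ennreal (erlang_density 0 (1 + w) y * y ^ 1) \<partial>lborel)"
    proof (rule nn_integral_cong)
      fix y :: real
      show "ennreal (?e y) * (ennreal y * ennreal (?e (y * w))) = ennreal (1 / (1 + w)) * ennreal (erlang_density 0 (1 + w) y * y ^ 1)"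
      proof (cases "0 \<le> y")
        case y: True
        have "?e y * (y * ?e (y * w)) = 1 / (1 + w) * (erlang_density 0 (1 + w) y * y ^ 1)"
        proof -
          have "exp (- y) * exp (- (y * w)) = exp (- ((1 + w) * y))"
            by (simp add: exp_add[symmetric] algebra_simps)
          moreover have "erlang_density 0 (1 + w) y = (1 + w) * exp (- ((1 + w) * y))"
            using y by (simp add: erlang_density_def algebra_simps)
          moreover have "?e y = exp (- y)" "?e (y * w) = exp (- (y * w))"
            using True y by (simp_all add: exponential_density_def mult_less_0_iff)
          ultimately show ?thesis
            using True by simp
        qed
        then show ?thesis
          using True y by (simp add: ennreal_mult[symmetric])
      next
        case False
        then show ?thesis by (simp add: exponential_density_def erlang_density_def)
      qed
    qed
    also have "\<dots> = ennreal (1 / (1 + w)) * ennreal (fact (0 + 1) / (fact 0 * (1 + w) ^ 1))"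
      using True nn_integral_erlang_ith_moment[of "1 + w" 0 1] by (subst nn_integral_cmult) auto
    also have "\<dots> = ?f w"
      using True by (simp add: ennreal_mult[symmetric] power2_eq_square)
    finally show ?thesis .
  next
    case False
    with that have "w < 0" by simp
    then have "(\<integral>\<^sup>+y. ennreal (?e y) * (ennreal y * ennreal (?e (y * w))) \<partial>lborel) = (\<integral>\<^sup>+y. 0 \<partial>(lborel :: real measure))"
      by (intro nn_integral_cong) (auto simp: exponential_density_def mult_less_0_iff ennreal_neg)
    then show ?thesis using False by simp
  qed
  have "distr M lborel (\<lambda>\<omega>. E1 \<omega> / E2 \<omega>) = density lborel ?f"
  proof (rule measure_eqI)
    fix A assume "A \<in> sets (distr M lborel (\<lambda>\<omega>. E1 \<omega> / E2 \<omega>))"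
    then have A[measurable]: "A \<in> sets borel" by simp
    have "emeasure (distr M lborel (\<lambda>\<omega>. E1 \<omega> / E2 \<omega>)) A = (\<integral>\<^sup>+x. indicator A x \<partial>distr M lborel (\<lambda>\<omega>. E1 \<omega> / E2 \<omega>))"
      by simp
    also have "\<dots> = (\<integral>\<^sup>+\<omega>. indicator A (fst (E1 \<omega>, E2 \<omega>) / snd (E1 \<omega>, E2 \<omega>)) \<partial>M)"
      by (subst nn_integral_distr) auto
    also have "\<dots> = (\<integral>\<^sup>+y. \<integral>\<^sup>+x. indicator A (fst (x, y) / snd (x, y)) \<partial>distr M borel E1 \<partial>distr M borel E2)"
      by (rule nn_integral_indep_pair[OF ind]) measurable
    also have "\<dots> = (\<integral>\<^sup>+y. ennreal (?e y) * (\<integral>\<^sup>+x. ennreal (?e x) * indicator A (x / y) \<partial>lborel) \<partial>lborel)"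
      unfolding distr_borel_of_distributed[OF E1] distr_borel_of_distributed[OF E2]
      by (simp add: nn_integral_density)
    also have "\<dots> = (\<integral>\<^sup>+y. \<integral>\<^sup>+w. ennreal (?e y) * (ennreal y * ennreal (?e (y * w))) * indicator A w \<partial>lborel \<partial>lborel)"
    proof (rule nn_integral_cong_AE)
      have "AE y in lborel. y \<noteq> (0::real)" by (rule AE_lborel_singleton)
      then show "AE y in lborel. ennreal (?e y) * (\<integral>\<^sup>+x. ennreal (?e x) * indicator A (x / y) \<partial>lborel)
         = (\<integral>\<^sup>+w. ennreal (?e y) * (ennreal y * ennreal (?e (y * w))) * indicator A w \<partial>lborel)"
      proof eventually_elim
        case (elim y)
        show ?case
        proof (cases "0 < y")
          case True
          then have "(\<integral>\<^sup>+x. ennreal (?e x) * indicator A (x / y) \<partial>lborel)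
              = ennreal y * (\<integral>\<^sup>+w. ennreal (?e (y * w)) * indicator A w \<partial>lborel)"
            by (subst nn_integral_real_affine[where c=y and t=0]) simp_all
          then show ?thesis
            by (simp add: nn_integral_cmult[symmetric] mult.assoc)
        next
          case False
          with elim show ?thesis by (simp add: exponential_density_def)
        qed
      qed
    qed
    also have "\<dots> = (\<integral>\<^sup>+w. \<integral>\<^sup>+y. ennreal (?e y) * (ennreal y * ennreal (?e (y * w))) * indicator A w \<partial>lborel \<partial>lborel)"
      by (rule lborel_pair.Fubini') measurable
    also have "\<dots> = (\<integral>\<^sup>+w. ?f w * indicator A w \<partial>lborel)"
    proof (rule nn_integral_cong_AE)
      have "AE w in lborel. w \<noteq> (0::real)" by (rule AE_lborel_singleton)
      then show "AE w in lborel. (\<integral>\<^sup>+y. ennreal (?e y) * (ennreal y * ennreal (?e (y * w))) * indicator A w \<partial>lborel) = ?f w * indicator A w"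
      proof eventually_elim
        case (elim w)
        then show ?case
          using inner[OF elim] by (subst nn_integral_multc) auto
      qed
    qed
    also have "\<dots> = emeasure (density lborel ?f) A"
      by (subst emeasure_density) auto
    finally show "emeasure (distr M lborel (\<lambda>\<omega>. E1 \<omega> / E2 \<omega>)) A = emeasure (density lborel ?f) A" .
  qed simp
  then show ?thesis
    unfolding distributed_def by auto
qed

text \<open>
  Integration by parts and partial fractions give the antiderivative
  \<open>- ln (1 + l x) / (1 + x) + l / (l - 1) * ln ((1 + l x) / (1 + x))\<close>, which vanishes at 0. For \<open>l = 1\<close>
  the last term is replaced by \<open>- 1 / (1 + x)\<close>.
\<close>

lemma nn_integral_ln_ratio_density:
  fixes l :: real
  assumes l: "0 < l"
  shows "(\<integral>\<^sup>+x. ennreal (ln (1 + l * x) / (1 + x)\<^sup>2) * indicator {0..} x \<partial>lborel)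
       = ennreal (if l = 1 then 1 else l / (l - 1) * ln l)"
proof -
  let ?f = "\<lambda>x. ln (1 + l * x) / (1 + x)\<^sup>2"
  define H where "H x = (if l = 1 then - (ln (1 + x) / (1 + x)) - 1 / (1 + x)
      else - (ln (1 + l * x) / (1 + x)) + l / (l - 1) * ln ((1 + l * x) / (1 + x)))" for x
  let ?v = "if l = 1 then 0 else l / (l - 1) * ln l"
  have H: "DERIV H x :> ?f x" if x: "0 \<le> x" for x
  proof -
    have "0 < 1 + x" "0 < 1 + l * x"
      using x l by (simp_all add: add_pos_nonneg)
    then have p: "1 + x \<noteq> 0" "1 + l * x \<noteq> 0" "0 < (1 + l * x) / (1 + x)" "0 < 1 + x" "0 < 1 + l * x"
      by auto
    have alg: "(l / a * b - L * 1) / (b * b) = l / (a * b) - L / b\<^sup>2" if "a \<noteq> 0" "b \<noteq> 0" for a b L :: real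
      using that by (simp add: diff_divide_distrib power2_eq_square)
    have alg': "(l * b - a * 1) / (b * b) / (a / b) = (l * b - a) / (a * b)" if "a \<noteq> 0" "b \<noteq> 0" for a b :: real
      using that by (simp add: divide_simps)
    have "((\<lambda>x. ln (1 + l * x) / (1 + x)) has_real_derivative
        (l / (1 + l * x) * (1 + x) - ln (1 + l * x) * 1) / ((1 + x) * (1 + x))) (at x)"
      using p by (auto intro!: derivative_eq_intros)
    then have D1: "((\<lambda>x. ln (1 + l * x) / (1 + x)) has_real_derivative l / ((1 + l * x) * (1 + x)) - ?f x) (at x)"
      unfolding alg[OF p(2,1)] .
    show ?thesis
    proof (cases "l = 1")
      case True
      have "((\<lambda>x. 1 / (1 + x)) has_real_derivative - (1 / ((1 + x) * (1 + x)))) (at x)"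
        using p by (auto intro!: derivative_eq_intros)
      from DERIV_diff[OF DERIV_minus[OF D1] this] show ?thesis
        using True by (simp add: H_def[abs_def])
    next
      case False
      have "((\<lambda>x. ln ((1 + l * x) / (1 + x))) has_real_derivative
          (l * (1 + x) - (1 + l * x) * 1) / ((1 + x) * (1 + x)) / ((1 + l * x) / (1 + x))) (at x)"
        using p by (intro DERIV_ln_divide[THEN DERIV_chain2, THEN DERIV_cong]) (auto intro!: derivative_eq_intros)
      then have "((\<lambda>x. ln ((1 + l * x) / (1 + x))) has_real_derivative (l - 1) / ((1 + l * x) * (1 + x))) (at x)"
        unfolding alg'[OF p(2,1)] by (simp add: algebra_simps)
      from DERIV_add[OF DERIV_minus[OF D1] DERIV_cmult[OF this, of "l / (l - 1)"]]
      show ?thesis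
        using False by (simp add: H_def[abs_def])
    qed
  qed
  have lim: "(H \<longlongrightarrow> ?v) at_top"
  proof (cases "l = 1")
    case True
    have "((\<lambda>x::real. - (ln (1 + x) / (1 + x)) - 1 / (1 + x)) \<longlongrightarrow> 0) at_top"
      by real_asymp
    then show ?thesis using True by (simp add: H_def[abs_def])
  next
    case False
    have "((\<lambda>x. ln (1 + l * x) / (1 + x)) \<longlongrightarrow> 0) at_top"
      using l by real_asymp
    moreover have "((\<lambda>x. (1 + l * x) / (1 + x)) \<longlongrightarrow> l) at_top"
      using l by real_asymp
    ultimately have "((\<lambda>x. - (ln (1 + l * x) / (1 + x)) + l / (l - 1) * ln ((1 + l * x) / (1 + x))) \<longlongrightarrow> - 0 + l / (l - 1) * ln l) at_top"
      using l by (intro tendsto_intros) auto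
    then show ?thesis using False by (simp add: H_def[abs_def])
  qed
  have "(\<integral>\<^sup>+x. ennreal (?f x) * indicator {0..} x \<partial>lborel) = ennreal (?v - H 0)"
    by (rule nn_integral_FTC_atLeast[OF _ H _ lim]) (use l in auto)
  then show ?thesis
    by (simp add: H_def)
qed

lemma (in prob_space) ln_moment_of_ratio_density:
  fixes W :: "'a \<Rightarrow> real" and l :: real
  assumes W: "distributed M lborel W (\<lambda>x. ennreal (if x > 0 then 1 / (1 + x)\<^sup>2 else 0))" and l: "0 < l"
  shows "integrable M (\<lambda>\<omega>. ln (1 + l * W \<omega>))"
    and "(\<integral>\<omega>. ln (1 + l * W \<omega>) \<partial>M) = (if l = 1 then 1 else l / (l - 1) * ln l)"
    and "psi (nonneg_law M W) l = (\<integral>\<omega>. ln (1 + l * W \<omega>) \<partial>M)"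
proof -
  let ?f = "\<lambda>x. ennreal (if x > 0 then 1 / (1 + x)\<^sup>2 else 0)"
  let ?v = "if l = 1 then 1 else l / (l - 1) * ln l"
  have [measurable]: "W \<in> borel_measurable M"
    using W by (simp add: distributed_def)
  have law: "distr M borel W = density lborel ?f"
    by (rule distr_borel_of_distributed[OF W])
  have "AE x in distr M borel W. 0 < x"
    unfolding law by (subst AE_density) auto
  then have pos: "AE \<omega> in M. 0 < W \<omega>"
    by (subst (asm) AE_distr_iff) auto
  have nonneg: "AE \<omega> in M. 0 \<le> ln (1 + l * W \<omega>)"
    using pos by eventually_elim (use l in simp)
  have v: "0 \<le> ?v"
  proof (cases "1 < l")
    case False
    then show ?thesis
      using l divide_nonpos_neg[of "l * ln l" "l - 1"] mult_nonneg_nonpos[of l "ln l"] by auto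
  qed simp
  have "(\<integral>\<^sup>+\<omega>. ennreal (ln (1 + l * W \<omega>)) \<partial>M) = (\<integral>\<^sup>+x. ennreal (ln (1 + l * x)) \<partial>distr M borel W)"
    by (subst nn_integral_distr) auto
  also have "\<dots> = (\<integral>\<^sup>+x. ?f x * ennreal (ln (1 + l * x)) \<partial>lborel)"
    unfolding law by (subst nn_integral_density) auto
  also have "\<dots> = (\<integral>\<^sup>+x. ennreal (ln (1 + l * x) / (1 + x)\<^sup>2) * indicator {0..} x \<partial>lborel)"
  proof (rule nn_integral_cong)
    fix x :: real
    show "?f x * ennreal (ln (1 + l * x)) = ennreal (ln (1 + l * x) / (1 + x)\<^sup>2) * indicator {0..} x"
    proof (cases "0 < x")
      case True
      then have "0 \<le> ln (1 + l * x)" using l by simp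
      then have "ennreal (1 / (1 + x)\<^sup>2) * ennreal (ln (1 + l * x)) = ennreal (1 / (1 + x)\<^sup>2 * ln (1 + l * x))"
        by (intro ennreal_mult[symmetric]) auto
      then show ?thesis using True by simp
    next
      case False
      then show ?thesis by (cases "x = 0") auto
    qed
  qed
  also have "\<dots> = ennreal ?v"
    by (rule nn_integral_ln_ratio_density[OF l])
  finally have nn: "(\<integral>\<^sup>+\<omega>. ennreal (ln (1 + l * W \<omega>)) \<partial>M) = ennreal ?v" .
  then show "integrable M (\<lambda>\<omega>. ln (1 + l * W \<omega>))"
    using nonneg by (intro integrableI_nonneg) auto
  show "(\<integral>\<omega>. ln (1 + l * W \<omega>) \<partial>M) = ?v"
    using nonneg nn v by (subst integral_eq_nn_integral) auto
  have "psi (nonneg_law M W) l = (\<integral>x. indicator {0..} x *\<^sub>R ln (1 + l * x) \<partial>distr M borel W)"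
    unfolding psi_def nonneg_law_def by (subst integral_restrict_space) auto
  also have "\<dots> = (\<integral>\<omega>. indicator {0..} (W \<omega>) *\<^sub>R ln (1 + l * W \<omega>) \<partial>M)"
    by (subst integral_distr) auto
  also have "\<dots> = (\<integral>\<omega>. ln (1 + l * W \<omega>) \<partial>M)"
  proof (rule integral_cong_AE)
    show "AE \<omega> in M. indicator {0..} (W \<omega>) *\<^sub>R ln (1 + l * W \<omega>) = ln (1 + l * W \<omega>)"
      using pos by eventually_elim simp
  qed auto
  finally show "psi (nonneg_law M W) l = (\<integral>\<omega>. ln (1 + l * W \<omega>) \<partial>M)" .
qed

text \<open>
  Integrate over \<open>G\<close> first: the Laplace transform of an exponential variable at \<open>l X\<close> is \<open>1 / (1 + l X)\<close>.
\<close>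

lemma (in prob_space) Laplace_exponential_times:
  fixes G X :: "'a \<Rightarrow> real" and l :: real
  assumes G: "distributed M lborel G (\<lambda>x. ennreal (exponential_density 1 x))"
    and ind: "indep_var borel G borel X" and X0: "AE \<omega> in M. 0 \<le> X \<omega>" and l: "0 \<le> l"
  shows "(\<integral>\<omega>. exp (- l * (G \<omega> * X \<omega>)) \<partial>M) = (\<integral>\<omega>. 1 / (1 + l * X \<omega>) \<partial>M)"
proof -
  have m[measurable]: "G \<in> borel_measurable M" "X \<in> borel_measurable M"
    using ind unfolding indep_var_distribution_eq by auto
  have "(\<integral>\<^sup>+\<omega>. ennreal (exp (- l * (G \<omega> * X \<omega>))) \<partial>M)
      = (\<integral>\<^sup>+\<omega>. ennreal (exp (- l * (fst (G \<omega>, X \<omega>) * snd (G \<omega>, X \<omega>)))) \<partial>M)"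
    by simp
  also have "\<dots> = (\<integral>\<^sup>+x. \<integral>\<^sup>+g. ennreal (exp (- l * (fst (g, x) * snd (g, x)))) \<partial>distr M borel G \<partial>distr M borel X)"
    by (rule nn_integral_indep_pair[OF ind]) measurable
  also have "\<dots> = (\<integral>\<^sup>+x. \<integral>\<^sup>+g. ennreal (exponential_density 1 g) * ennreal (exp (- (l * x) * g)) \<partial>lborel \<partial>distr M borel X)"
    unfolding distr_borel_of_distributed[OF G] by (simp add: nn_integral_density mult_ac)
  also have "\<dots> = (\<integral>\<^sup>+\<omega>. \<integral>\<^sup>+g. ennreal (exponential_density 1 g) * ennreal (exp (- (l * X \<omega>) * g)) \<partial>lborel \<partial>M)"
    by (subst nn_integral_distr) auto
  also have "\<dots> = (\<integral>\<^sup>+\<omega>. ennreal (1 / (1 + l * X \<omega>)) \<partial>M)"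
  proof (rule nn_integral_cong_AE)
    show "AE \<omega> in M. (\<integral>\<^sup>+g. ennreal (exponential_density 1 g) * ennreal (exp (- (l * X \<omega>) * g)) \<partial>lborel) = ennreal (1 / (1 + l * X \<omega>))"
      using X0
    proof eventually_elim
      case (elim \<omega>)
      then show ?case
        using l by (intro nn_integral_exponential_Laplace) simp
    qed
  qed
  finally have nn: "(\<integral>\<^sup>+\<omega>. ennreal (exp (- l * (G \<omega> * X \<omega>))) \<partial>M) = (\<integral>\<^sup>+\<omega>. ennreal (1 / (1 + l * X \<omega>)) \<partial>M)" .
  have "AE \<omega> in M. 0 \<le> 1 / (1 + l * X \<omega>)"
    using X0 by eventually_elim (use l in simp)
  then show ?thesis
    using nn by (simp add: integral_eq_nn_integral)
qed


section \<open>The exponential ratio and its Dirichlet mean\<close>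

theorem proposition4p1:
  fixes B :: "'b measure" and E1 E2 W :: "'b \<Rightarrow> real"
    and A :: "'a measure" and T :: "'a \<Rightarrow> real"
    and K :: "'k measure" and P :: "'k \<Rightarrow> real measure"
    and N :: "'n measure" and G M :: "'n \<Rightarrow> real"
    and FW :: "real measure"
  assumes B: "prob_space B"
    and E1: "distributed B lborel E1 (\<lambda>x. ennreal (exponential_density 1 x))"
    and E2: "distributed B lborel E2 (\<lambda>x. ennreal (exponential_density 1 x))"
    and E_indep: "prob_space.indep_var B borel E1 borel E2"
    and W: "W = (\<lambda>\<omega>. E1 \<omega> / E2 \<omega>)"
    and FW: "FW = nonneg_law B W"
    and T: "GGC A 1 FW T"
    and P: "dirichlet_process K 1 FW P"
    and N: "prob_space N"
    and G: "distributed N lborel G (\<lambda>x. ennreal (exponential_density 1 x))"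
    and M: "M \<in> borel_measurable N"
           "distr N borel M = distr K borel (random_mean P)"
    and GM_indep: "prob_space.indep_var N borel G borel M"
  shows "distributed B lborel W (\<lambda>x. ennreal (if x > 0 then 1 / (1 + x)\<^sup>2 else 0))
    \<and> (\<forall>l>0. integrable B (\<lambda>\<omega>. ln (1 + l * W \<omega>))
             \<and> psi FW l = (\<integral>\<omega>. ln (1 + l * W \<omega>) \<partial>B)
             \<and> psi FW l = (if l = 1 then 1 else l / (l - 1) * ln l))
    \<and> ((\<lambda>l::real. l / (l - 1) * ln l) \<longlongrightarrow> 1) (at 1)
    \<and> (AE \<omega> in K. integrable (P \<omega>) (\<lambda>x. x))
    \<and> distr A borel T = distr N borel (\<lambda>\<omega>. G \<omega> * M \<omega>)
    \<and> distributed N lborel M (\<lambda>x. ennreal (xi x))"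
proof -
  interpret B: prob_space B by (rule B)
  interpret K: prob_space K using P by (simp add: dirichlet_process_def)
  interpret N: prob_space N by (rule N)
  interpret A: prob_space A using T by (simp add: GGC_def)
  have GX[measurable]: "G \<in> borel_measurable N" and MX[measurable]: "M \<in> borel_measurable N"
    using GM_indep M(1) unfolding N.indep_var_distribution_eq by auto
  have TX: "T \<in> borel_measurable A" "AE \<omega> in A. 0 \<le> T \<omega>"
    using T by (auto simp: GGC_def)
  have Wd: "distributed B lborel W (\<lambda>x. ennreal (if x > 0 then 1 / (1 + x)\<^sup>2 else 0))"
    unfolding W by (rule B.distributed_exponential_ratio[OF E1 E2 E_indep])
  note Wln = B.ln_moment_of_ratio_density[OF Wd]
  have psi: "psi FW l = (if l = 1 then 1 else l / (l - 1) * ln l)" if "0 < l" for l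
    using Wln(2,3)[OF that] by (simp add: FW)
  have lim: "((\<lambda>l::real. l / (l - 1) * ln l) \<longlongrightarrow> 1) (at 1)"
    by real_asymp
  have fin: "integrable FW (\<lambda>x. ln (1 + l * x))" if "0 \<le> l" for l
    using T that by (simp add: GGC_def)
  note mean = dirichlet_mean_transform[OF P fin]
  note mean_m[measurable] = mean(1)
  have Pm: "P \<in> measurable K (prob_algebra nonneg_borel)"
    using P by (simp add: dirichlet_process_def)
  have M0: "AE \<omega> in N. 0 \<le> M \<omega>"
  proof -
    have "AE \<omega> in K. 0 \<le> random_mean P \<omega>"
    proof (rule AE_I2)
      fix \<omega> assume "\<omega> \<in> space K"
      then have "P \<omega> \<in> space (prob_algebra nonneg_borel)"
        by (rule measurable_space[OF Pm])
      then have "space (P \<omega>) = {0..}"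
        by (auto simp: space_prob_algebra space_restrict_space dest: sets_eq_imp_space_eq)
      then show "0 \<le> random_mean P \<omega>"
        unfolding random_mean_def by (intro integral_nonneg_AE AE_I2) simp
    qed
    then have "AE x in distr K borel (random_mean P). 0 \<le> x"
      by (subst AE_distr_iff) auto
    then have "AE x in distr N borel M. 0 \<le> x"
      unfolding M(2) .
    then show ?thesis
      by (subst (asm) AE_distr_iff) auto
  qed
  \<comment> \<open>The law of \<open>T\<close> follows from this by randomizing \<open>l\<close> with \<open>G\<close>, the law of \<open>M\<close> by comparison with \<open>xi\<close>.\<close>
  have MT: "(\<integral>\<omega>. 1 / (1 + l * M \<omega>) \<partial>N) = exp (- psi FW l)" if "0 \<le> l" for l
  proof -
    have "(\<integral>\<omega>. 1 / (1 + l * M \<omega>) \<partial>N) = (\<integral>x. 1 / (1 + l * x) \<partial>distr N borel M)"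
      by (subst integral_distr) auto
    also have "\<dots> = (\<integral>\<omega>. 1 / (1 + l * random_mean P \<omega>) \<partial>K)"
      unfolding M(2) by (subst integral_distr) auto
    also have "\<dots> = exp (- psi FW l)"
      using that by (intro mean(3)) auto
    finally show ?thesis .
  qed
  have law_T: "distr A borel T = distr N borel (\<lambda>\<omega>. G \<omega> * M \<omega>)"
  proof (rule distr_eq_of_Laplace_eq)
    have "AE x in distr N borel G. 0 \<le> x"
      unfolding distr_borel_of_distributed[OF G]
      by (subst AE_density) (auto simp: exponential_density_def)
    then have "AE \<omega> in N. 0 \<le> G \<omega>"
      by (subst (asm) AE_distr_iff) auto
    with M0 show "AE \<omega> in N. 0 \<le> G \<omega> * M \<omega>"
      by eventually_elim simp
    show "(\<integral>x. exp (- l * T x) \<partial>A) = (\<integral>x. exp (- l * (G x * M x)) \<partial>N)" if l: "0 \<le> l" for l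
    proof -
      have "(\<integral>x. exp (- l * T x) \<partial>A) = exp (- 1 * psi FW l)"
        using T l by (auto simp: GGC_def)
      also have "\<dots> = (\<integral>x. exp (- l * (G x * M x)) \<partial>N)"
        using N.Laplace_exponential_times[OF G GM_indep M0 l] MT[OF l] by simp
      finally show ?thesis .
    qed
  qed (use TX A.prob_space_axioms N in auto)
  have law_M: "distributed N lborel M (\<lambda>x. ennreal (xi x))"
  proof -
    let ?D = "density lborel (\<lambda>x. ennreal (xi x))"
    have "distr N borel M = distr ?D borel (\<lambda>x. x)"
    proof (rule distr_eq_of_Stieltjes_eq[OF N prob_space_xi])
      show "AE x in ?D. 0 \<le> x"
        by (subst AE_density) (auto simp: xi_def)
      fix l :: real assume l: "0 < l"
      have "(\<integral>\<^sup>+x. ennreal (1 / (1 + l * x)) \<partial>?D) = (\<integral>\<^sup>+x. ennreal (xi x / (1 + l * x)) \<partial>lborel)"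
      proof -
        have "ennreal (xi x) * ennreal (1 / (1 + l * x)) = ennreal (xi x / (1 + l * x))" for x
          using l xi_nonneg[of x] by (cases "0 < x") (simp_all add: ennreal_mult[symmetric] add_pos_pos xi_def)
        then show ?thesis
          by (subst nn_integral_density) auto
      qed
      also have "\<dots> = ennreal (exp (- psi FW l))"
        unfolding psi[OF l] by (rule nn_integral_xi_Stieltjes[OF l])
      finally have "(\<integral>x. 1 / (1 + l * x) \<partial>?D) = exp (- psi FW l)"
        using \<open>AE x in ?D. 0 \<le> x\<close> l
        by (subst integral_eq_nn_integral) (auto elim!: eventually_mono)
      then show "(\<integral>x. 1 / (1 + l * M x) \<partial>N) = (\<integral>x. 1 / (1 + l * x) \<partial>?D)"
        using MT l by simp
    qed (use M0 in auto)
    also have "\<dots> = ?D"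
      by (rule distr_id2) simp
    also have "distr N borel M = distr N lborel M"
      by (rule distr_cong) auto
    finally show ?thesis
      unfolding distributed_def by auto
  qed
  show ?thesis
    using Wd Wln(1) Wln(3) psi lim mean(2) law_T law_M by (auto simp: FW)
qed

end
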